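(* Let $p_1,p_2\ge 3$ be integers and let $J$ be a $(p_1,p_2)$-periodic Jacobi-block-Jacobi operator on $\ell^2(\mathbb{Z},\ell^2(\mathbb{Z}))$ with entries $a_{q,r},c_{q,r}\in\mathbb{R}$ and $\alpha_{q,r},b_{q,r}\in\mathbb{C}$, $q,r\in\mathbb{Z}$ (as defined in the context). Then the Lebesgue measure $|\sigma(J)|$ of the spectrum of $J$ satisfies $$|\sigma(J)|\le \min_{(m,n)\in\mathbb{Z}^2}R_{m,n},$$ where $$R_{m,n}:=4\sum_{j=1}^{p_1}\bigl(|b_{j,n}|+2|\alpha_{j,n}|\bigr)+4\sum_{k=1}^{p_2}\bigl(|a_{m,k}|+2|\alpha_{m,k}|\bigr)-8|\alpha_{m,n}|.$$
   Context: A double sequence $\{w_{q,r}\}_{q,r\in\mathbb{Z}}$ of complex numbers is $(p_1,p_2)$-periodic if $w_{q+k_1p_1,\,r+k_2p_2}=w_{q,r}$ for all $q,r,k_1,k_2\in\mathbb{Z}$. For a bounded real sequence $\{d_r\}_{r\in\mathbb{Z}}$ and a bounded complex sequence $\{e_r\}_{r\in\mathbb{Z}}$, $J(\{d_r\},\{e_r\})$ denotes the (bounded, self-adjoint) Hermitian Jacobi matrix on $\ell^2(\mathbb{Z})$ with $d_r$ on the main diagonal, $e_r$ on the diagonal above it and the conjugates $\overline{e_r}$ on the diagonal below it: $(J(\{d_r\},\{e_r\})v)_r=\overline{e_{r-1}}\,v_{r-1}+d_r v_r+e_r v_{r+1}$. A Jacobi-block-Jacobi operator $J$ acts on $\ell^2(\mathbb{Z},\ell^2(\mathbb{Z}))$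 by $$(Ju)_q=A_{q-1}u_{q-1}+B_qu_q+A_qu_{q+1},\qquad q\in\mathbb{Z},\quad u_q\in\ell^2(\mathbb{Z}),$$ with $A_q=J(\{a_{q,r}\}_{r\in\mathbb{Z}},\{\alpha_{q,r}\}_{r\in\mathbb{Z}})$ and $B_q=J(\{c_{q,r}\}_{r\in\mathbb{Z}},\{b_{q,r}\}_{r\in\mathbb{Z}})$, where $a_{q,r},c_{q,r}$ are real and $\alpha_{q,r},b_{q,r}$ are complex. It is called $(p_1,p_2)$-periodic if the four double sequences $\{a_{q,r}\},\{\alpha_{q,r}\},\{c_{q,r}\},\{b_{q,r}\}$ are all $(p_1,p_2)$-periodic; in that case $J$ is bounded and self-adjoint. The spectrum of $J$ is denoted $\sigma(J)\subset\mathbb{R}$ and $|\cdot|$ denotes Lebesgue measure of subsets of $\mathbb{R}$. *)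

theory Defs
  imports "HOL-Analysis.Analysis"
begin

section \<open>The Hilbert spaces\<close>

definition l2 :: "(int \<Rightarrow> complex) set" where
  "l2 = {v. (\<lambda>r. (cmod (v r))\<^sup>2) summable_on UNIV}"

definition l2_norm :: "(int \<Rightarrow> complex) \<Rightarrow> real" where
  "l2_norm v = sqrt (\<Sum>\<^sub>\<infinity>r. (cmod (v r))\<^sup>2)"

text \<open>The space of square-summable two-sided sequences with values in \<open>l2\<close>;
  the vector \<open>u q\<close> is the \<open>q\<close>-th entry of \<open>u\<close>.\<close>

definition l2l2 :: "(int \<Rightarrow> int \<Rightarrow> complex) set" where
  "l2l2 = {u. (\<forall>q. u q \<in> l2) \<and> (\<lambda>q. (l2_norm (u q))\<^sup>2) summable_on UNIV}"

definition l2l2_norm :: "(int \<Rightarrow> int \<Rightarrow> complex) \<Rightarrow> real" where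
  "l2l2_norm u = sqrt (\<Sum>\<^sub>\<infinity>q. (l2_norm (u q))\<^sup>2)"

section \<open>Bounded operators and the spectrum\<close>

text \<open>Operators are functions on all double sequences; only their values on \<open>l2l2\<close> matter.\<close>

definition bounded_op ::
  "((int \<Rightarrow> int \<Rightarrow> complex) \<Rightarrow> (int \<Rightarrow> int \<Rightarrow> complex)) \<Rightarrow> bool" where
  "bounded_op S \<longleftrightarrow>
     (\<forall>u\<in>l2l2. S u \<in> l2l2) \<and>
     (\<forall>u\<in>l2l2. \<forall>v\<in>l2l2. S (\<lambda>q r. u q r + v q r) = (\<lambda>q r. S u q r + S v q r)) \<and>
     (\<forall>z. \<forall>u\<in>l2l2. S (\<lambda>q r. z * u q r) = (\<lambda>q r. z * S u q r)) \<and>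
     (\<exists>C. \<forall>u\<in>l2l2. l2l2_norm (S u) \<le> C * l2l2_norm u)"

text \<open>The complex numbers \<open>z\<close> for which \<open>T - z\<close> has no bounded two-sided inverse;
  \<open>T\<close> is meant to satisfy \<open>bounded_op\<close>.\<close>

definition spectrum ::
  "((int \<Rightarrow> int \<Rightarrow> complex) \<Rightarrow> (int \<Rightarrow> int \<Rightarrow> complex)) \<Rightarrow> complex set" where
  "spectrum T = {z. \<not> (\<exists>S. bounded_op S \<and>
     (\<forall>u\<in>l2l2. S (\<lambda>q r. T u q r - z * u q r) = u) \<and>
     (\<forall>u\<in>l2l2. (\<lambda>q r. T (S u) q r - z * S u q r) = u))}"

section \<open>Jacobi-block-Jacobi operators\<close>

definition periodic2 :: "int \<Rightarrow> int \<Rightarrow> (int \<Rightarrow> int \<Rightarrow> 'a) \<Rightarrow> bool" where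
  "periodic2 p1 p2 w \<longleftrightarrow> (\<forall>q r k1 k2. w (q + k1 * p1) (r + k2 * p2) = w q r)"

definition jacobi ::
  "(int \<Rightarrow> real) \<Rightarrow> (int \<Rightarrow> complex) \<Rightarrow> (int \<Rightarrow> complex) \<Rightarrow> (int \<Rightarrow> complex)" where
  "jacobi d e v =
     (\<lambda>r. cnj (e (r - 1)) * v (r - 1) + complex_of_real (d r) * v r + e r * v (r + 1))"

text \<open>The off-diagonal blocks are \<open>jacobi (a q) (\<alpha> q)\<close>, the diagonal blocks
  \<open>jacobi (c q) (b q)\<close>.\<close>

definition jbj ::
  "(int \<Rightarrow> int \<Rightarrow> real) \<Rightarrow> (int \<Rightarrow> int \<Rightarrow> complex) \<Rightarrow>
   (int \<Rightarrow> int \<Rightarrow> real) \<Rightarrow> (int \<Rightarrow> int \<Rightarrow> complex) \<Rightarrow>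
   (int \<Rightarrow> int \<Rightarrow> complex) \<Rightarrow> (int \<Rightarrow> int \<Rightarrow> complex)" where
  "jbj a \<alpha> c b u =
     (\<lambda>q r. jacobi (a (q - 1)) (\<alpha> (q - 1)) (u (q - 1)) r
          + jacobi (c q) (b q) (u q) r
          + jacobi (a q) (\<alpha> q) (u (q + 1)) r)"

definition jbj_R ::
  "int \<Rightarrow> int \<Rightarrow> (int \<Rightarrow> int \<Rightarrow> real) \<Rightarrow> (int \<Rightarrow> int \<Rightarrow> complex) \<Rightarrow>
   (int \<Rightarrow> int \<Rightarrow> complex) \<Rightarrow> int \<Rightarrow> int \<Rightarrow> real" where
  "jbj_R p1 p2 a \<alpha> b m n =
     4 * (\<Sum>j=1..p1. cmod (b j n) + 2 * cmod (\<alpha> j n))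
   + 4 * (\<Sum>k=1..p2. \<bar>a m k\<bar> + 2 * cmod (\<alpha> m k))
   - 8 * cmod (\<alpha> m n)"

text \<open>By periodicity \<open>jbj_R\<close> takes finitely many values, so that its minimum
  over all pairs of integers, written with \<open>Min\<close>, is a genuine minimum.\<close>

lemma periodic2_mod:
  assumes "periodic2 p1 p2 w"
  shows "w (q mod p1) (r mod p2) = w q r"
    and "w (q mod p1) r = w q r"
    and "w q (r mod p2) = w q r"
proof -
  have *: "w (q + k1 * p1) (r + k2 * p2) = w q r" for q r k1 k2
    using assms by (simp add: periodic2_def)
  show "w (q mod p1) (r mod p2) = w q r"
    using *[of "q mod p1" "q div p1" "r mod p2" "r div p2"] by (simp add: algebra_simps)
  show "w (q mod p1) r = w q r"
    using *[of "q mod p1" "q div p1" r 0] by (simp add: algebra_simps)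
  show "w q (r mod p2) = w q r"
    using *[of q 0 "r mod p2" "r div p2"] by (simp add: algebra_simps)
qed

lemma finite_range_jbj_R:
  assumes "p1 > 0" "p2 > 0"
    and "periodic2 p1 p2 a" "periodic2 p1 p2 \<alpha>" "periodic2 p1 p2 b"
  shows "finite (range (\<lambda>(m, n). jbj_R p1 p2 a \<alpha> b m n))"
proof (rule finite_subset)
  have mod_eq: "jbj_R p1 p2 a \<alpha> b (m mod p1) (n mod p2) = jbj_R p1 p2 a \<alpha> b m n" for m n
    by (simp add: jbj_R_def periodic2_mod[OF assms(3)] periodic2_mod[OF assms(4)]
        periodic2_mod[OF assms(5)])
  show "range (\<lambda>(m, n). jbj_R p1 p2 a \<alpha> b m n)
      \<subseteq> (\<lambda>(m, n). jbj_R p1 p2 a \<alpha> b m n) ` ({0..<p1} \<times> {0..<p2})"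
  proof (clarify, rule image_eqI)
    fix m n
    show "jbj_R p1 p2 a \<alpha> b m n =
        (case (m mod p1, n mod p2) of (m, n) \<Rightarrow> jbj_R p1 p2 a \<alpha> b m n)"
      by (simp add: mod_eq)
    show "(m mod p1, n mod p2) \<in> {0..<p1} \<times> {0..<p2}"
      using assms(1,2) by simp
  qed
qed simp

end

theory Submission
  imports Defs
begin

text \<open>
  Let \<open>F\<close> be the rectangle \<open>{m+1..m+p1} \<times> {n+1..n+p2}\<close>. Its translates by multiples of the
  periods, the cells, tile the lattice of index pairs \<open>(q, r)\<close>. Regard \<open>J\<close> as a weighted graph
  on this lattice: the diagonal entries are \<open>c\<close>, and each site \<open>i\<close> is joined to \<open>i + (0, 1)\<close>,
  \<open>i + (1, 0)\<close>, \<open>i + (1, 1)\<close> and \<open>i + (1, -1)\<close> by edges that carry entries of \<open>b\<close>, of \<open>a\<close> and, for the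
  last two, of \<open>\<alpha>\<close>. An edge is cut if it joins two different cells.

  Deleting the cut edges turns \<open>J\<close> into a direct sum \<open>J\<^sub>0\<close> of copies of one Hermitian matrix on
  \<open>F\<close>. A deleted edge of weight \<open>e\<close> between sites with values \<open>x\<close> and \<open>y\<close> contributes at most
  \<open>\<bar>e\<bar> (\<bar>x\<bar>\<^sup>2 + \<bar>y\<bar>\<^sup>2)\<close> to the quadratic form, so \<open>J\<^sub>0 - D \<le> J \<le> J\<^sub>0 + D\<close> for the periodic diagonal
  operator \<open>D\<close> whose entry at a site is the sum of the moduli of the cut edges there
  (\<open>abs_inner_lattice_op_diff_le\<close>). Both bounds act cell by cell.

  Let \<open>\<mu>\<close> and \<open>\<nu>\<close> be the eigenvalues of the matrices of \<open>J\<^sub>0 - D\<close> and \<open>J\<^sub>0 + D\<close> on \<open>F\<close>, and let \<open>x\<close> be none of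
  them. The eigenvectors with \<open>\<nu> < x\<close> and those with \<open>\<mu> > x\<close> span spaces that meet only in \<open>0\<close>,
  since a common vector \<open>v \<noteq> 0\<close> would give \<open>x \<bar>v\<bar>\<^sup>2 < \<langle>(J\<^sub>0 - D) v, v\<rangle> \<le> \<langle>(J\<^sub>0 + D) v, v\<rangle> < x \<bar>v\<bar>\<^sup>2\<close>. Counting
  dimensions, at least as many \<open>\<mu>\<close> as \<open>\<nu>\<close> lie below \<open>x\<close>. The excess is a nonnegative integer whose
  integral over \<open>x\<close> is \<open>\<Sum>\<nu> - \<Sum>\<mu> = 2 tr D\<close>, where \<open>tr D\<close> is the trace over one cell. Hence it vanishes outside
  a set \<open>E\<close> of measure at most \<open>2 tr D\<close>, in which the finitely many eigenvalues are included
  (\<open>form_splitting_off_small_set\<close>). Each cut edge has two ends, so \<open>2 tr D\<close> is four times the total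
  cut weight per cell, and counting the edges that leave the rectangle gives exactly \<open>R\<^sub>m\<^sub>,\<^sub>n\<close>
  (\<open>crossing_weight_eq_jbj_R\<close>).

  If \<open>x\<close> is outside \<open>E\<close>, the two spaces have complementary dimensions, so splitting every cell of a
  vector yields \<open>u = v + w\<close> with \<open>\<langle>(J - x) v, v\<rangle> \<le> - \<delta> \<bar>v\<bar>\<^sup>2\<close> and \<open>\<langle>(J - x) w, w\<rangle> \<ge> \<delta> \<bar>w\<bar>\<^sup>2\<close>. Testing
  \<open>(J - x) u\<close> against \<open>w - v\<close> shows that \<open>J - x\<close> is bounded below
  (\<open>indefinite_splitting_bounded_below\<close>), and a symmetric operator that is bounded below is
  invertible (\<open>bounded_below_symmetric_imp_bij\<close>). So the spectrum is contained in \<open>E\<close>. This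
  holds for every \<open>(m, n)\<close>, in particular for a minimizing one.
\<close>

section \<open>The Hilbert space of square-summable families\<close>

text \<open>A type instead of a set of functions, so that the type classes of inner product spaces and
  complete metric spaces apply.\<close>

typedef 'i ell2 = "{f :: 'i \<Rightarrow> complex. (\<lambda>i. (cmod (f i))\<^sup>2) summable_on UNIV}"
  morphisms coord Ell2
  by (rule exI[of _ "\<lambda>_. 0"]) simp

setup_lifting type_definition_ell2

lemma coord_summable: "(\<lambda>i. (cmod (coord u i))\<^sup>2) summable_on UNIV"
  using coord[of u] by simp

lemma ell2_eqI: "(\<And>i. coord u i = coord v i) \<Longrightarrow> u = v"
  by (simp add: coord_inject[symmetric] ext)

lemma abs_inner_le_squares:
  "\<bar>inner x y\<bar> \<le> (cmod x)\<^sup>2 + (cmod y)\<^sup>2"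
proof -
  have "\<bar>inner x y\<bar> \<le> cmod x * cmod y"
    by (rule Cauchy_Schwarz_ineq2)
  also have "\<dots> \<le> (cmod x)\<^sup>2 + (cmod y)\<^sup>2"
    using sum_squares_bound[of "cmod x" "cmod y"] mult_nonneg_nonneg[OF norm_ge_zero norm_ge_zero, of x y]
    by linarith
  finally show ?thesis .
qed

lemma norm_add_square_le: "(cmod (x + y))\<^sup>2 \<le> 2 * (cmod x)\<^sup>2 + 2 * (cmod y)\<^sup>2"
proof -
  have "(cmod (x + y))\<^sup>2 \<le> (cmod x + cmod y)\<^sup>2"
    by (intro power_mono norm_triangle_ineq norm_ge_zero)
  also have "\<dots> \<le> 2 * (cmod x)\<^sup>2 + 2 * (cmod y)\<^sup>2"
    using sum_squares_bound[of "cmod x" "cmod y"] by (simp add: power2_sum)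
  finally show ?thesis .
qed

lemma summable_inner_coord: "(\<lambda>i. inner (coord u i) (coord v i)) summable_on UNIV"
proof -
  have "(\<lambda>i. (cmod (coord u i))\<^sup>2 + (cmod (coord v i))\<^sup>2) summable_on UNIV"
    by (intro summable_on_add coord_summable)
  then have "(\<lambda>i. norm (inner (coord u i) (coord v i))) summable_on UNIV"
    by (rule summable_on_comparison_test) (auto intro: abs_inner_le_squares)
  then show ?thesis
    by (rule abs_summable_summable)
qed

instantiation ell2 :: (type) real_vector
begin

lift_definition zero_ell2 :: "'a ell2" is "\<lambda>_. 0"
  by simp

lift_definition plus_ell2 :: "'a ell2 \<Rightarrow> 'a ell2 \<Rightarrow> 'a ell2" is "\<lambda>f g i. f i + g i"
proof -
  fix f g :: "'a \<Rightarrow> complex"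
  assume "(\<lambda>i. (cmod (f i))\<^sup>2) summable_on UNIV" "(\<lambda>i. (cmod (g i))\<^sup>2) summable_on UNIV"
  then have "(\<lambda>i. 2 * (cmod (f i))\<^sup>2 + 2 * (cmod (g i))\<^sup>2) summable_on UNIV"
    by (intro summable_on_add summable_on_cmult_right)
  then show "(\<lambda>i. (cmod (f i + g i))\<^sup>2) summable_on UNIV"
    by (rule summable_on_comparison_test) (auto intro: norm_add_square_le)
qed

lift_definition scaleR_ell2 :: "real \<Rightarrow> 'a ell2 \<Rightarrow> 'a ell2" is "\<lambda>t f i. t *\<^sub>R f i"
  by (simp add: power_mult_distrib summable_on_cmult_right)

lift_definition uminus_ell2 :: "'a ell2 \<Rightarrow> 'a ell2" is "\<lambda>f i. - f i"
  by simp

definition minus_ell2 :: "'a ell2 \<Rightarrow> 'a ell2 \<Rightarrow> 'a ell2" where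
  "minus_ell2 u v = u + - v"

instance
proof
  fix u v w :: "'a ell2" and s t :: real
  show "u + v + w = u + (v + w)" "u + v = v + u" "0 + u = u" "- u + u = 0"
    by (rule ell2_eqI, simp only: zero_ell2.rep_eq plus_ell2.rep_eq uminus_ell2.rep_eq
        ac_simps add_0 left_minus right_minus)+
  show "u - v = u + - v"
    by (fact minus_ell2_def)
  show "t *\<^sub>R (u + v) = t *\<^sub>R u + t *\<^sub>R v" "(s + t) *\<^sub>R u = s *\<^sub>R u + t *\<^sub>R u"
    "s *\<^sub>R t *\<^sub>R u = (s * t) *\<^sub>R u" "1 *\<^sub>R u = u"
    by (rule ell2_eqI, simp only: plus_ell2.rep_eq scaleR_ell2.rep_eq
        scaleR_add_right scaleR_add_left scaleR_scaleR scaleR_one)+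
qed

end

lemma coord_simps [simp]:
  "coord 0 i = 0" "coord (u + v) i = coord u i + coord v i"
  "coord (t *\<^sub>R u) i = t *\<^sub>R coord u i" "coord (- u) i = - coord u i"
  "coord (u - v) i = coord u i - coord v i"
  by (simp_all only: minus_ell2_def zero_ell2.rep_eq plus_ell2.rep_eq
      scaleR_ell2.rep_eq uminus_ell2.rep_eq diff_conv_add_uminus)

lemma coord_sum [simp]: "coord (sum f A) i = (\<Sum>a\<in>A. coord (f a) i)"
  by (induction A rule: infinite_finite_induct) auto

instantiation ell2 :: (type) real_inner
begin

definition inner_ell2 :: "'a ell2 \<Rightarrow> 'a ell2 \<Rightarrow> real" where
  "inner_ell2 u v = (\<Sum>\<^sub>\<infinity>i. inner (coord u i) (coord v i))"

definition norm_ell2 :: "'a ell2 \<Rightarrow> real" where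
  "norm_ell2 u = sqrt (inner u u)"

definition dist_ell2 :: "'a ell2 \<Rightarrow> 'a ell2 \<Rightarrow> real" where
  "dist_ell2 u v = norm (u - v)"

definition sgn_ell2 :: "'a ell2 \<Rightarrow> 'a ell2" where
  "sgn_ell2 u = u /\<^sub>R norm u"

definition uniformity_ell2 :: "('a ell2 \<times> 'a ell2) filter" where
  "uniformity_ell2 = (INF e\<in>{0 <..}. principal {(x, y). dist x y < e})"

definition open_ell2 :: "'a ell2 set \<Rightarrow> bool" where
  "open_ell2 S = (\<forall>x\<in>S. \<forall>\<^sub>F (x', y) in uniformity. x' = x \<longrightarrow> y \<in> S)"

instance
proof
  fix u v w :: "'a ell2" and t :: real
  show "inner u v = inner v u"
    by (simp add: inner_ell2_def inner_commute)
  show "inner (u + v) w = inner u w + inner v w"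
    by (simp add: inner_ell2_def inner_add_left infsum_add summable_inner_coord)
  show "inner (t *\<^sub>R u) v = t * inner u v"
    by (simp add: inner_ell2_def infsum_cmult_right')
  show "0 \<le> inner u u"
    by (simp add: inner_ell2_def infsum_nonneg)
  show "inner u u = 0 \<longleftrightarrow> u = 0"
  proof
    assume *: "inner u u = 0"
    show "u = 0"
    proof (rule ell2_eqI)
      fix i
      have "inner (coord u i) (coord u i) = 0"
        by (rule nonneg_infsum_le_0D[where A = UNIV])
          (use * in \<open>auto simp: inner_ell2_def summable_inner_coord\<close>)
      then show "coord u i = coord 0 i"
        by simp
    qed
  qed (simp add: inner_ell2_def)
qed (simp_all add: norm_ell2_def dist_ell2_def sgn_ell2_def uniformity_ell2_def open_ell2_def)

end

lemma norm_ell2_square: "(norm u)\<^sup>2 = (\<Sum>\<^sub>\<infinity>i. (cmod (coord u i))\<^sup>2)"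
  by (simp add: power2_norm_eq_inner inner_ell2_def)

lemma sum_coord_le_norm: "finite A \<Longrightarrow> (\<Sum>i\<in>A. (cmod (coord u i))\<^sup>2) \<le> (norm u)\<^sup>2"
  unfolding norm_ell2_square by (rule finite_sum_le_infsum) (auto simp: coord_summable)

lemma cmod_coord_le_norm: "cmod (coord u i) \<le> norm u"
  using sum_coord_le_norm[of "{i}" u] by (simp add: power2_le_iff_abs_le)

lemma norm_ell2_le:
  assumes "\<And>A. finite A \<Longrightarrow> (\<Sum>i\<in>A. (cmod (coord u i))\<^sup>2) \<le> C\<^sup>2" and "0 \<le> C"
  shows "norm u \<le> C"
proof -
  have "(norm u)\<^sup>2 \<le> C\<^sup>2"
    unfolding norm_ell2_square
    by (rule infsum_le_finite_sums) (auto simp: coord_summable assms(1))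
  then show ?thesis
    using assms(2) power2_le_imp_le by blast
qed

instance ell2 :: (type) complete_space
proof
  fix X :: "nat \<Rightarrow> 'a ell2"
  assume X: "Cauchy X"
  have lim: "\<exists>l. (\<lambda>n. coord (X n) i) \<longlonglongrightarrow> l" for i
  proof -
    have "Cauchy (\<lambda>n. coord (X n) i)"
    proof (rule metric_CauchyI)
      fix e :: real assume "e > 0"
      then obtain M where M: "\<And>m n. m \<ge> M \<Longrightarrow> n \<ge> M \<Longrightarrow> dist (X m) (X n) < e"
        using X by (meson Cauchy_def)
      have "dist (coord (X m) i) (coord (X n) i) < e" if "m \<ge> M" "n \<ge> M" for m n
        using M[OF that] cmod_coord_le_norm[of "X m - X n" i] by (simp add: dist_norm)
      then show "\<exists>M. \<forall>m\<ge>M. \<forall>n\<ge>M. dist (coord (X m) i) (coord (X n) i) < e"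
        by blast
    qed
    then show ?thesis
      by (simp add: Cauchy_convergent_iff convergent_def)
  qed
  then obtain f where f: "\<And>i. (\<lambda>n. coord (X n) i) \<longlonglongrightarrow> f i"
    by metis
  \<comment> \<open>Bounds on finite partial sums pass to the coordinatewise limit.\<close>
  have fin: "(\<Sum>i\<in>A. (cmod (coord (X n) i - f i))\<^sup>2) \<le> e\<^sup>2"
    if "finite A" "\<And>m. m \<ge> n \<Longrightarrow> dist (X n) (X m) \<le> e" for A n e
  proof (rule tendsto_upperbound)
    show "(\<lambda>m. \<Sum>i\<in>A. (cmod (coord (X n) i - coord (X m) i))\<^sup>2)
        \<longlonglongrightarrow> (\<Sum>i\<in>A. (cmod (coord (X n) i - f i))\<^sup>2)"
      by (intro tendsto_intros f)
    have "(\<Sum>i\<in>A. (cmod (coord (X n) i - coord (X m) i))\<^sup>2) \<le> e\<^sup>2" if "m \<ge> n" for m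
    proof -
      have "(\<Sum>i\<in>A. (cmod (coord (X n) i - coord (X m) i))\<^sup>2) \<le> (dist (X n) (X m))\<^sup>2"
        using sum_coord_le_norm[OF \<open>finite A\<close>, of "X n - X m"] by (simp add: dist_norm)
      also have "\<dots> \<le> e\<^sup>2"
        using \<open>m \<ge> n\<close> \<open>\<And>m. m \<ge> n \<Longrightarrow> dist (X n) (X m) \<le> e\<close> by (simp add: power_mono)
      finally show ?thesis .
    qed
    then show "\<forall>\<^sub>F m in sequentially. (\<Sum>i\<in>A. (cmod (coord (X n) i - coord (X m) i))\<^sup>2) \<le> e\<^sup>2"
      by (auto simp: eventually_sequentially)
  qed simp
  obtain M where M: "\<And>m n. m \<ge> M \<Longrightarrow> n \<ge> M \<Longrightarrow> dist (X m) (X n) < 1"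
    using X by (meson Cauchy_def zero_less_one)
  have "(\<lambda>i. (cmod (coord (X M) i - f i))\<^sup>2) summable_on UNIV"
    by (rule nonneg_bounded_partial_sums_imp_summable_on[where C = "1\<^sup>2"])
      (auto intro!: eventually_finite_subsets_at_top_weakI fin less_imp_le[OF M]
        simp del: power_one)
  then have sf: "(\<lambda>i. (cmod (f i))\<^sup>2) summable_on UNIV"
  proof -
    assume *: "(\<lambda>i. (cmod (coord (X M) i - f i))\<^sup>2) summable_on UNIV"
    have "coord (X M - Ell2 (\<lambda>i. coord (X M) i - f i)) i = f i" for i
      using * by (simp add: Ell2_inverse)
    then show ?thesis
      using coord_summable[of "X M - Ell2 (\<lambda>i. coord (X M) i - f i)"] by simp
  qed
  have cf: "coord (Ell2 f) i = f i" for i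
    using sf by (simp add: Ell2_inverse)
  have "X \<longlonglongrightarrow> Ell2 f"
  proof (rule metric_LIMSEQ_I)
    fix e :: real assume "e > 0"
    then obtain N where N: "\<And>m n. m \<ge> N \<Longrightarrow> n \<ge> N \<Longrightarrow> dist (X m) (X n) < e / 2"
      using X by (meson Cauchy_def half_gt_zero)
    have "dist (X n) (Ell2 f) < e" if "n \<ge> N" for n
    proof -
      have "norm (X n - Ell2 f) \<le> e / 2"
        using \<open>e > 0\<close> \<open>n \<ge> N\<close>
        by (intro norm_ell2_le) (auto simp: cf intro!: fin less_imp_le[OF N])
      then show ?thesis
        using \<open>e > 0\<close> by (simp add: dist_norm)
    qed
    then show "\<exists>N. \<forall>n\<ge>N. dist (X n) (Ell2 f) < e"
      by blast
  qed
  then show "convergent X"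
    by (auto simp: convergent_def)
qed

section \<open>Invertibility of symmetric operators\<close>

text \<open>The operator \<open>A\<^sup>2\<close> lies between two positive constants, hence is invertible by a contraction
  argument; surjectivity of \<open>A\<^sup>2\<close> implies that of \<open>A\<close>.\<close>

lemma bounded_below_symmetric_imp_bij:
  fixes A :: "'a::{real_inner, complete_space} \<Rightarrow> 'a"
  assumes A: "bounded_linear A"
    and sym: "\<And>u v. inner (A u) v = inner u (A v)"
    and below: "\<And>u. c * norm u \<le> norm (A u)" and "c > 0"
  shows "bij A"
proof -
  interpret A: bounded_linear A by (rule A)
  obtain M where M: "M > 0" "\<And>u. norm (A u) \<le> norm u * M"
    using A.pos_bounded by auto
  define B where "B = max M c"
  have B: "B > 0" "c \<le> B" "\<And>u. norm (A u) \<le> B * norm u"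
    using M \<open>c > 0\<close> order_trans[OF M(2) mult_left_mono[OF max.cobounded1 norm_ge_zero]]
    unfolding B_def by (auto simp: mult.commute)
  define q where "q = sqrt (1 - c\<^sup>2 / B\<^sup>2)"
  have cB: "0 < c\<^sup>2 / B\<^sup>2" "c\<^sup>2 / B\<^sup>2 \<le> 1"
    using B \<open>c > 0\<close> by (auto simp: power_mono)
  then have q: "0 \<le> q" "q < 1"
    by (auto simp: q_def)
  \<comment> \<open>With \<open>c\<^sup>2 \<le> A\<^sup>2 \<le> B\<^sup>2\<close>, the map \<open>1 - A\<^sup>2 / B\<^sup>2\<close> is a contraction.\<close>
  have contr: "norm (u - A (A u) /\<^sub>R B\<^sup>2) \<le> q * norm u" for u
  proof -
    define w where "w = A (A u) /\<^sub>R B\<^sup>2"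
    have "(norm (u - w))\<^sup>2 = (norm u)\<^sup>2 - 2 * inner u w + (norm w)\<^sup>2"
      by (simp add: power2_norm_eq_inner inner_diff_left inner_diff_right inner_commute[of w u])
    moreover have "inner u w = (norm (A u))\<^sup>2 / B\<^sup>2"
      by (simp add: w_def power2_norm_eq_inner sym[of u, symmetric] divide_inverse mult.commute)
    moreover have "norm w = norm (A (A u)) / B\<^sup>2"
      by (simp add: w_def divide_inverse mult.commute)
    ultimately have "(norm (u - w))\<^sup>2
        = (norm u)\<^sup>2 - 2 * (norm (A u))\<^sup>2 / B\<^sup>2 + (norm (A (A u)))\<^sup>2 / B ^ 4"
      by (simp add: power_divide flip: power_mult)
    also have "\<dots> \<le> (norm u)\<^sup>2 - 2 * (norm (A u))\<^sup>2 / B\<^sup>2 + (norm (A u))\<^sup>2 / B\<^sup>2"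
    proof -
      have "(norm (A (A u)))\<^sup>2 \<le> (B * norm (A u))\<^sup>2"
        by (intro power_mono B(3) norm_ge_zero)
      then have "(norm (A (A u)))\<^sup>2 / B ^ 4 \<le> (B * norm (A u))\<^sup>2 / B ^ 4"
        using B(1) by (simp add: divide_right_mono)
      also have "\<dots> = (norm (A u))\<^sup>2 / B\<^sup>2"
        using B(1) by (simp add: field_simps power2_eq_square power4_eq_xxxx)
      finally show ?thesis by simp
    qed
    also have "\<dots> = (norm u)\<^sup>2 - (norm (A u))\<^sup>2 / B\<^sup>2"
      by (simp add: field_simps)
    also have "\<dots> \<le> (norm u)\<^sup>2 - (c * norm u)\<^sup>2 / B\<^sup>2"
      using below[of u] \<open>c > 0\<close>
      by (intro diff_left_mono divide_right_mono power_mono) auto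
    also have "\<dots> = (q * norm u)\<^sup>2"
      using cB by (simp add: q_def power_mult_distrib algebra_simps)
    finally have "norm (u - w) \<le> q * norm u"
      by (rule power2_le_imp_le) (simp add: q)
    then show ?thesis
      by (simp add: w_def)
  qed
  have "\<exists>u. A u = f" for f
  proof -
    have "\<exists>!u. u - (A (A u) - f) /\<^sub>R B\<^sup>2 = u"
    proof (rule banach_fix_type[OF q], intro allI)
      fix u v
      have "(u - (A (A u) - f) /\<^sub>R B\<^sup>2) - (v - (A (A v) - f) /\<^sub>R B\<^sup>2)
          = (u - v) - A (A (u - v)) /\<^sub>R B\<^sup>2"
        by (simp add: A.diff algebra_simps)
      then show "dist (u - (A (A u) - f) /\<^sub>R B\<^sup>2) (v - (A (A v) - f) /\<^sub>R B\<^sup>2) \<le> q * dist u v"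
        unfolding dist_norm by (simp only: contr)
    qed
    then show ?thesis
      using B(1) by auto
  qed
  moreover have "inj A"
  proof (rule injI)
    fix u v assume "A u = A v"
    then have "c * norm (u - v) \<le> 0"
      using below[of "u - v"] by (simp add: A.diff)
    then show "u = v"
      using \<open>c > 0\<close> by (simp add: mult_le_0_iff)
  qed
  ultimately show ?thesis
    by (metis bijI surjI surj_def)
qed

text \<open>In the pairing of \<open>A u\<close> with \<open>w - v\<close> the two mixed terms \<open>\<langle>A v, w\<rangle>\<close> and \<open>\<langle>A w, v\<rangle>\<close> cancel by
  symmetry; what remains is \<open>\<langle>A w, w\<rangle> - \<langle>A v, v\<rangle>\<close>, to which the two assumptions contribute with the same sign.\<close>

lemma indefinite_splitting_bounded_below:
  fixes A :: "'a::real_inner \<Rightarrow> 'a"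
  assumes add: "\<And>u v. A (u + v) = A u + A v"
    and sym: "\<And>u v. inner (A u) v = inner u (A v)"
    and "u = v + w" "0 < \<delta>"
    and neg: "inner (A v) v \<le> - \<delta> * (norm v)\<^sup>2" and pos: "\<delta> * (norm w)\<^sup>2 \<le> inner (A w) w"
  shows "\<delta> / 2 * norm u \<le> norm (A u)"
proof -
  define s where "s = norm v + norm w"
  have "norm u \<le> s"
    using norm_triangle_ineq[of v w] by (simp add: s_def assms(3))
  have "\<delta> * (norm v)\<^sup>2 + \<delta> * (norm w)\<^sup>2 \<le> inner (A w) w - inner (A v) v"
    using neg pos by simp
  also have "\<dots> = inner (A u) (w - v)"
  proof -
    have "inner (A v) w = inner (A w) v"
      using sym[of v w] by (simp add: inner_commute)
    then show ?thesis
      by (simp add: assms(3) add inner_add_left inner_diff_right)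
  qed
  also have "\<dots> \<le> norm (A u) * norm (w - v)"
    by (rule norm_cauchy_schwarz)
  also have "\<dots> \<le> norm (A u) * s"
    using norm_triangle_ineq4[of w v] by (intro mult_left_mono) (auto simp: s_def)
  finally have *: "\<delta> * ((norm v)\<^sup>2 + (norm w)\<^sup>2) \<le> norm (A u) * s"
    by (simp add: algebra_simps)
  have "s\<^sup>2 \<le> 2 * ((norm v)\<^sup>2 + (norm w)\<^sup>2)"
    using sum_squares_bound[of "norm v" "norm w"] by (simp add: s_def power2_sum)
  then have "\<delta> * s\<^sup>2 \<le> 2 * (norm (A u) * s)"
    using * mult_left_mono[of "s\<^sup>2" "2 * ((norm v)\<^sup>2 + (norm w)\<^sup>2)" \<delta>] \<open>0 < \<delta>\<close>
    by (simp add: algebra_simps)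
  then have "(\<delta> * s) * s \<le> (2 * norm (A u)) * s"
    by (simp add: power2_eq_square mult_ac)
  then have "s = 0 \<or> \<delta> * s \<le> 2 * norm (A u)"
    using mult_right_le_imp_le[of "\<delta> * s" s "2 * norm (A u)"] by (auto simp: s_def add_nonneg_eq_0_iff less_le)
  then have "\<delta> * s \<le> 2 * norm (A u)"
    by auto
  moreover have "\<delta> * norm u \<le> \<delta> * s"
    using \<open>norm u \<le> s\<close> \<open>0 < \<delta>\<close> by simp
  ultimately show ?thesis
    by simp
qed

section \<open>Hermitian forms on finitely many sites\<close>

text \<open>Gaussian elimination, one equation at a time. All dimension counts below reduce to this
  fact.\<close>

lemma homogeneous_system_solvable:
  fixes M :: "'k \<Rightarrow> 'i \<Rightarrow> complex"
  assumes "finite K" "finite F" "card K < card F"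
  shows "\<exists>v. (\<exists>i\<in>F. v i \<noteq> 0) \<and> (\<forall>k\<in>K. (\<Sum>i\<in>F. M k i * v i) = 0)"
  using assms
proof (induction K arbitrary: F M rule: finite_induct)
  case empty
  then obtain i where "i \<in> F" by fastforce
  then show ?case
    by (intro exI[of _ "\<lambda>_. 1"]) auto
next
  case (insert k K)
  show ?case
  proof (cases "\<forall>i\<in>F. M k i = 0")
    case True
    have "card K < card F" using insert by simp
    from insert.IH[OF \<open>finite F\<close> this, of M] True show ?thesis
      by auto
  next
    case False
    then obtain p where p: "p \<in> F" "M k p \<noteq> 0" by auto
    have "card K < card (F - {p})"
      using insert p by simp
    \<comment> \<open>Eliminate the unknown \<open>v p\<close> by means of equation \<open>k\<close>.\<close>
    from insert.IH[OF _ this, of "\<lambda>l i. M l i - M l p / M k p * M k i"] insert.prems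
    obtain v where v: "\<exists>i\<in>F - {p}. v i \<noteq> 0"
      "\<And>l. l \<in> K \<Longrightarrow> (\<Sum>i\<in>F - {p}. (M l i - M l p / M k p * M k i) * v i) = 0"
      by auto
    define w where "w = v (p := - (\<Sum>i\<in>F - {p}. M k i * v i) / M k p)"
    have w: "(\<Sum>i\<in>F. M l i * w i) = M l p * w p + (\<Sum>i\<in>F - {p}. M l i * v i)" for l
      using p insert.prems by (simp add: sum.remove[of F p] w_def)
    have "(\<Sum>i\<in>F. M l i * w i) = 0" if "l \<in> insert k K" for l
    proof (cases "l = k")
      case True
      then show ?thesis using p by (simp add: w) (simp add: w_def)
    next
      case False
      then have "(\<Sum>i\<in>F - {p}. M l i * v i) = M l p / M k p * (\<Sum>i\<in>F - {p}. M k i * v i)"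
        using v(2)[of l] that by (simp add: algebra_simps sum_subtractf sum_distrib_left)
      then show ?thesis by (simp add: w) (simp add: w_def)
    qed
    moreover have "\<exists>i\<in>F. w i \<noteq> 0" using v(1) by (auto simp: w_def)
    ultimately show ?thesis by blast
  qed
qed

text \<open>Vectors on the finite site set \<open>F\<close> are total functions; all notions below see only their
  values on \<open>F\<close>. This allows \<open>F\<close> to vary, which index types of vectors do not.\<close>

definition sprod :: "'i set \<Rightarrow> ('i \<Rightarrow> complex) \<Rightarrow> ('i \<Rightarrow> complex) \<Rightarrow> complex" where
  "sprod F u v = (\<Sum>i\<in>F. u i * cnj (v i))"

definition mat_app :: "'i set \<Rightarrow> ('i \<Rightarrow> 'i \<Rightarrow> complex) \<Rightarrow> ('i \<Rightarrow> complex) \<Rightarrow> 'i \<Rightarrow> complex" where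
  "mat_app F h v i = (\<Sum>j\<in>F. h i j * v j)"

definition orthonormal :: "'i set \<Rightarrow> 'k set \<Rightarrow> ('k \<Rightarrow> 'i \<Rightarrow> complex) \<Rightarrow> bool" where
  "orthonormal F K e \<longleftrightarrow> (\<forall>k\<in>K. \<forall>l\<in>K. sprod F (e k) (e l) = (if k = l then 1 else 0))"

definition hermitian_on :: "'i set \<Rightarrow> ('i \<Rightarrow> 'i \<Rightarrow> complex) \<Rightarrow> bool" where
  "hermitian_on F h \<longleftrightarrow> (\<forall>i\<in>F. \<forall>j\<in>F. h i j = cnj (h j i))"

definition hform :: "'i set \<Rightarrow> ('i \<Rightarrow> 'i \<Rightarrow> complex) \<Rightarrow> ('i \<Rightarrow> complex) \<Rightarrow> real" where
  "hform F h v = Re (sprod F (mat_app F h v) v)"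

lemma cnj_sprod: "cnj (sprod F u v) = sprod F v u"
  by (simp add: sprod_def mult.commute)

lemma sprod_lincomb_left:
  "sprod F (\<lambda>i. \<Sum>k\<in>K. c k * e k i) v = (\<Sum>k\<in>K. c k * sprod F (e k) v)"
  by (simp add: sprod_def sum_distrib_left sum_distrib_right mult.assoc sum.swap[of _ F K])

lemma sprod_lincomb_right:
  "sprod F u (\<lambda>i. \<Sum>k\<in>K. c k * e k i) = (\<Sum>k\<in>K. cnj (c k) * sprod F u (e k))"
  by (simp add: sprod_def sum_distrib_left sum_distrib_right mult_ac sum.swap[of _ F K])

lemma mat_app_lincomb:
  "mat_app F h (\<lambda>i. \<Sum>k\<in>K. c k * e k i) i = (\<Sum>k\<in>K. c k * mat_app F h (e k) i)"
  by (simp add: mat_app_def sum_distrib_left mult_ac sum.swap[of _ F K])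

lemma sprod_self: "sprod F v v = of_real (\<Sum>i\<in>F. (cmod (v i))\<^sup>2)"
  by (simp add: sprod_def complex_norm_square flip: of_real_power)

lemma sprod_self_eq_0_iff: "finite F \<Longrightarrow> sprod F v v = 0 \<longleftrightarrow> (\<forall>i\<in>F. v i = 0)"
  by (simp add: sprod_self sum_nonneg_eq_0_iff del: of_real_sum)

lemma sprod_mat_app:
  assumes "hermitian_on F h"
  shows "sprod F (mat_app F h u) v = sprod F u (mat_app F h v)"
proof -
  have "sprod F (mat_app F h u) v = (\<Sum>i\<in>F. \<Sum>j\<in>F. h i j * u j * cnj (v i))"
    by (simp add: sprod_def mat_app_def sum_distrib_right)
  also have "\<dots> = (\<Sum>j\<in>F. \<Sum>i\<in>F. h i j * u j * cnj (v i))"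
    by (rule sum.swap)
  also have "\<dots> = (\<Sum>j\<in>F. \<Sum>i\<in>F. u j * cnj (h j i * v i))"
  proof (intro sum.cong refl)
    fix i j assume "j \<in> F" "i \<in> F"
    then have "h i j = cnj (h j i)"
      using assms unfolding hermitian_on_def by blast
    then show "h i j * u j * cnj (v i) = u j * cnj (h j i * v i)"
      by (simp only: complex_cnj_mult mult_ac)
  qed
  also have "\<dots> = sprod F u (mat_app F h v)"
    by (simp add: sprod_def mat_app_def sum_distrib_left)
  finally show ?thesis .
qed

lemma sprod_cong: "(\<And>i. i \<in> F \<Longrightarrow> u i = u' i) \<Longrightarrow> (\<And>i. i \<in> F \<Longrightarrow> v i = v' i) \<Longrightarrow> sprod F u v = sprod F u' v'"
  by (simp add: sprod_def)

text \<open>The first-order condition at a minimum, used for the variational characterization of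
  eigenvectors.\<close>

lemma quadratic_nonneg_imp_linear_zero:
  fixes p q :: real
  assumes "\<And>t. 0 \<le> t * p + t\<^sup>2 * q"
  shows "p = 0"
proof (rule ccontr)
  assume "p \<noteq> 0"
  define d where "d = \<bar>q\<bar> + 1"
  have d: "d > 0" "q - d < 0"
    by (auto simp: d_def)
  have "(- p / d) * p + (- p / d)\<^sup>2 * q = (p\<^sup>2 / d\<^sup>2) * (q - d)"
    using d by (simp add: field_simps power2_eq_square)
  also have "\<dots> < 0"
    using \<open>p \<noteq> 0\<close> d by (intro mult_pos_neg) auto
  finally show False
    using assms[of "- p / d"] by simp
qed

text \<open>The orthogonal complement of the given eigenvectors is nonzero by a dimension count and
  invariant under \<open>h\<close>. A maximizer of the form on its unit sphere, which exists by compactness, is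
  an eigenvector.\<close>

lemma hermitian_eigenvector_orthogonal:
  assumes "finite F" "finite K" "card K < card F" and h: "hermitian_on F h"
    and eig: "\<And>k i. k \<in> K \<Longrightarrow> i \<in> F \<Longrightarrow> mat_app F h (e k) i = of_real (lam k) * e k i"
  shows "\<exists>v \<mu>. (\<forall>k\<in>K. sprod F v (e k) = 0) \<and> sprod F v v = 1
    \<and> (\<forall>i\<in>F. mat_app F h v i = of_real \<mu> * v i)"
proof -
  \<comment> \<open>Prescribing the values off \<open>F\<close> makes \<open>S\<close> a closed subset of a compact product.\<close>
  define S where "S = {v. (\<forall>i. v i \<in> (if i \<in> F then cball 0 1 else {0})) \<and>
    (\<forall>k\<in>K. sprod F v (e k) = 0) \<and> sprod F v v = 1}"
  have cont: "continuous_on UNIV (\<lambda>v. v i)" for i :: 'a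
    by (rule continuous_on_product_coordinates)
  have "compact {v :: 'a \<Rightarrow> complex. \<forall>i. v i \<in> (if i \<in> F then cball 0 1 else {0})}"
  proof -
    have "compactin (product_topology (\<lambda>_. euclidean) UNIV)
       (PiE UNIV (\<lambda>i::'a. if i \<in> F then cball 0 1 else {0::complex}))"
      by (auto simp: compactin_PiE)
    then show ?thesis
      by (simp add: euclidean_product_topology PiE_def Pi_def)
  qed
  moreover have "closed {v. (\<forall>k\<in>K. sprod F v (e k) = 0) \<and> sprod F v v = 1}"
    unfolding sprod_def Ball_def
    by (intro closed_Collect_conj closed_Collect_all closed_Collect_imp open_Collect_const closed_Collect_eq continuous_intros cont)
  moreover have "S = {v. \<forall>i. v i \<in> (if i \<in> F then cball 0 1 else {0})}
     \<inter> {v. (\<forall>k\<in>K. sprod F v (e k) = 0) \<and> sprod F v v = 1}"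
    by (auto simp: S_def)
  ultimately have "compact S"
    by (simp only: compact_Int_closed)
  have scale: "\<exists>w\<in>S. \<exists>s. s \<noteq> 0 \<and> (\<forall>i\<in>F. v i = of_real s * w i)"
    if "\<exists>i\<in>F. v i \<noteq> 0" "\<forall>k\<in>K. sprod F v (e k) = 0" for v
  proof -
    define s where "s = sqrt (\<Sum>i\<in>F. (cmod (v i))\<^sup>2)"
    have s2: "sprod F v v = (of_real s)\<^sup>2"
      by (simp add: s_def sprod_self sum_nonneg flip: of_real_power)
    have "s \<noteq> 0"
      using s2 that(1) sprod_self_eq_0_iff[OF \<open>finite F\<close>, of v] by auto
    have "s \<ge> 0" by (simp add: s_def sum_nonneg)
    define w where "w = (\<lambda>i. if i \<in> F then v i / of_real s else 0)"
    have "cmod (v i) \<le> s" if "i \<in> F" for i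
      using member_le_sum[of i F "\<lambda>i. (cmod (v i))\<^sup>2"] that \<open>finite F\<close>
      by (auto simp: s_def real_le_rsqrt)
    then have "w i \<in> (if i \<in> F then cball 0 1 else {0})" for i
      using \<open>s \<noteq> 0\<close> \<open>s \<ge> 0\<close> by (auto simp: w_def norm_divide divide_le_eq)
    moreover have "sprod F w (e k) = sprod F v (e k) / of_real s" for k
      by (simp add: sprod_def w_def sum_divide_distrib)
    moreover have "sprod F w w = sprod F v v / (of_real s)\<^sup>2"
      by (simp add: sprod_def w_def sum_divide_distrib power2_eq_square)
    ultimately have "w \<in> S"
      using that(2) s2 \<open>s \<noteq> 0\<close> by (auto simp: S_def)
    then show ?thesis
      using \<open>s \<noteq> 0\<close> by (intro bexI[of _ w] exI[of _ s]) (auto simp: w_def)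
  qed
  obtain v0 where "\<exists>i\<in>F. v0 i \<noteq> 0" "\<forall>k\<in>K. (\<Sum>i\<in>F. cnj (e k i) * v0 i) = 0"
    using homogeneous_system_solvable[OF \<open>finite K\<close> \<open>finite F\<close> \<open>card K < card F\<close>, of "\<lambda>k i. cnj (e k i)"]
    by auto
  then have "S \<noteq> {}"
    using scale[of v0] by (auto simp: sprod_def mult.commute)
  have "continuous_on S (hform F h)"
    unfolding hform_def sprod_def mat_app_def
    by (intro continuous_intros continuous_on_subset[OF cont]) auto
  then obtain v where v: "v \<in> S" "\<And>w. w \<in> S \<Longrightarrow> hform F h w \<le> hform F h v"
    using continuous_attains_sup[OF \<open>compact S\<close> \<open>S \<noteq> {}\<close>] by blast
  define \<mu> where "\<mu> = hform F h v"
  \<comment> \<open>\<open>\<mu> - h\<close> is nonnegative on the orthogonal complement of the \<open>e k\<close> and vanishes at \<open>v\<close>.\<close>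
  have psd: "hform F h w \<le> \<mu> * Re (sprod F w w)" if orth: "\<forall>k\<in>K. sprod F w (e k) = 0" for w
  proof (cases "\<exists>i\<in>F. w i \<noteq> 0")
    case True
    then obtain w' s where w': "w' \<in> S" "s \<noteq> 0" "\<And>i. i \<in> F \<Longrightarrow> w i = of_real s * w' i"
      using scale[OF True orth] by blast
    have "mat_app F h w i = of_real s * mat_app F h w' i" for i
      by (simp add: mat_app_def w'(3) sum_distrib_left mult_ac cong: sum.cong)
    then have "hform F h w = s\<^sup>2 * hform F h w'"
      by (simp add: hform_def sprod_def w'(3) sum_distrib_left power2_eq_square mult_ac
          cong: sum.cong)
    moreover have "Re (sprod F w w) = s\<^sup>2"
    proof -
      have "sprod F w w = of_real (s\<^sup>2) * sprod F w' w'"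
        by (simp add: sprod_def w'(3) sum_distrib_left power2_eq_square mult_ac cong: sum.cong)
      then show ?thesis using w'(1) by (simp add: S_def del: of_real_power)
    qed
    ultimately show ?thesis
      using v(2)[OF w'(1)] by (simp add: \<mu>_def mult_right_mono mult.commute)
  next
    case False
    then have "hform F h w = 0" "sprod F w w = 0"
      by (auto simp: hform_def sprod_def intro!: sum.neutral)
    then show ?thesis by simp
  qed
  have vK: "\<forall>k\<in>K. sprod F v (e k) = 0" "sprod F v v = 1"
    using v(1) by (auto simp: S_def)
  define g where "g = (\<lambda>i. of_real \<mu> * v i - mat_app F h v i)"
  have gK: "sprod F g (e k) = 0" if "k \<in> K" for k
  proof -
    have "sprod F (mat_app F h v) (e k) = sprod F v (mat_app F h (e k))"
      by (rule sprod_mat_app[OF h])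
    also have "\<dots> = sprod F v (\<lambda>i. of_real (lam k) * e k i)"
      by (rule sprod_cong) (auto simp: eig that)
    also have "\<dots> = of_real (lam k) * sprod F v (e k)"
      by (simp add: sprod_def sum_distrib_left mult_ac)
    finally have "sprod F (mat_app F h v) (e k) = 0"
      using vK that by simp
    moreover have "sprod F g (e k) = of_real \<mu> * sprod F v (e k) - sprod F (mat_app F h v) (e k)"
      by (simp add: g_def sprod_def sum_subtractf sum_distrib_left algebra_simps)
    ultimately show ?thesis
      using vK that by simp
  qed
  have gv: "Re (sprod F g v) = 0"
  proof -
    have "sprod F g v = of_real \<mu> * sprod F v v - sprod F (mat_app F h v) v"
      by (simp add: g_def sprod_def sum_subtractf sum_distrib_left algebra_simps)
    then show ?thesis
      using vK by (simp add: \<mu>_def hform_def)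
  qed
  define G where "G = (\<lambda>i. of_real \<mu> * g i - mat_app F h g i)"
  \<comment> \<open>First variation of \<open>\<mu> - h\<close> at \<open>v\<close> in the direction \<open>g = (\<mu> - h) v\<close>.\<close>
  have "2 * Re (sprod F g g) = 0"
  proof (rule quadratic_nonneg_imp_linear_zero)
    fix t :: real
    define w where "w = (\<lambda>i. v i + of_real t * g i)"
    have "\<forall>k\<in>K. sprod F w (e k) = 0"
      using vK gK by (simp add: sprod_def w_def distrib_right sum.distrib mult.assoc flip: sum_distrib_left)
    then have "0 \<le> \<mu> * Re (sprod F w w) - hform F h w"
      using psd by simp
    also have "\<mu> * Re (sprod F w w) - hform F h w
       = Re (sprod F (\<lambda>i. of_real \<mu> * w i - mat_app F h w i) w)"
      by (simp add: hform_def sprod_def sum_subtractf sum_distrib_left algebra_simps)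
    also have "(\<lambda>i. of_real \<mu> * w i - mat_app F h w i) = (\<lambda>i. g i + of_real t * G i)"
      by (simp add: w_def g_def G_def mat_app_def algebra_simps sum.distrib sum_subtractf
          sum_distrib_left fun_eq_iff)
    also have "sprod F (\<lambda>i. g i + of_real t * G i) w
       = sprod F g v + of_real t * (sprod F g g)
         + of_real t * sprod F G v + of_real (t\<^sup>2) * sprod F G g"
      by (simp add: sprod_def w_def algebra_simps sum.distrib sum_subtractf sum_distrib_left
            power2_eq_square)
    also have "sprod F G v = sprod F g g"
    proof -
      have "sprod F G v = of_real \<mu> * sprod F g v - sprod F (mat_app F h g) v"
        by (simp add: G_def sprod_def sum_subtractf sum_distrib_left algebra_simps)
      also have "\<dots> = sprod F g (\<lambda>i. of_real \<mu> * v i) - sprod F g (mat_app F h v)"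
        by (simp add: sprod_mat_app[OF h]) (simp add: sprod_def sum_distrib_left mult_ac)
      also have "\<dots> = sprod F g g"
        by (simp add: sprod_def g_def sum_subtractf sum.distrib algebra_simps)
      finally show ?thesis .
    qed
    finally show "0 \<le> t * (2 * Re (sprod F g g))
        + t\<^sup>2 * Re (sprod F G g)"
      by (simp add: gv algebra_simps)
  qed
  then have "sprod F g g = 0"
    by (simp add: sprod_self del: of_real_sum)
  then have "\<forall>i\<in>F. mat_app F h v i = of_real \<mu> * v i"
    using sprod_self_eq_0_iff[OF \<open>finite F\<close>, of g] by (simp add: g_def)
  then show ?thesis
    using vK by blast
qed

lemma hermitian_eigenbasis:
  assumes "finite F" and h: "hermitian_on F h"
  obtains e lam where "orthonormal F F e"
    and "\<And>k i. k \<in> F \<Longrightarrow> i \<in> F \<Longrightarrow> mat_app F h (e k) i = of_real (lam k) * e k i"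
proof -
  have "\<exists>e lam. orthonormal F K e \<and>
      (\<forall>k\<in>K. \<forall>i\<in>F. mat_app F h (e k) i = of_real (lam k) * e k i)" if "K \<subseteq> F" for K
    using finite_subset[OF that \<open>finite F\<close>] that
  proof (induction K rule: finite_induct)
    case empty
    then show ?case by (simp add: orthonormal_def)
  next
    case (insert k K)
    then obtain e lam where e: "orthonormal F K e"
      and lam: "\<And>k i. k \<in> K \<Longrightarrow> i \<in> F \<Longrightarrow> mat_app F h (e k) i = of_real (lam k) * e k i"
      by blast
    have "card K < card F"
      using insert \<open>finite F\<close> by (intro psubset_card_mono) auto
    from hermitian_eigenvector_orthogonal[of F K h e lam, OF \<open>finite F\<close> \<open>finite K\<close> this h lam]
    obtain v \<mu> where v: "\<And>k. k \<in> K \<Longrightarrow> sprod F v (e k) = 0" "sprod F v v = 1"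
      "\<And>i. i \<in> F \<Longrightarrow> mat_app F h v i = of_real \<mu> * v i"
      by blast
    have "sprod F (e l) v = 0" if "l \<in> K" for l
      using v(1)[OF that] cnj_sprod[of F v "e l"] by simp
    then have "orthonormal F (insert k K) (e(k := v))"
      using e v(1,2) \<open>k \<notin> K\<close> by (auto simp: orthonormal_def)
    moreover have "mat_app F h ((e(k := v)) l) i = of_real ((lam(k := \<mu>)) l) * (e(k := v)) l i"
      if "l \<in> insert k K" "i \<in> F" for l i
      using lam v(3) that by auto
    ultimately show ?case
      by blast
  qed
  from this[OF subset_refl] show thesis
    using that by blast
qed

text \<open>The premise says that both families are linearly independent and that their spans meet only
  in \<open>0\<close>.\<close>

lemma card_add_le_if_trivial_intersection:
  fixes e :: "'k \<Rightarrow> 'i \<Rightarrow> complex" and f :: "'l \<Rightarrow> 'i \<Rightarrow> complex"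
  assumes "finite F" "finite K" "finite L"
    and triv: "\<And>c d. (\<And>i. i \<in> F \<Longrightarrow> (\<Sum>k\<in>K. c k * e k i) = (\<Sum>l\<in>L. d l * f l i))
      \<Longrightarrow> (\<forall>k\<in>K. c k = 0) \<and> (\<forall>l\<in>L. d l = 0)"
  shows "card K + card L \<le> card F"
proof (rule ccontr)
  assume "\<not> card K + card L \<le> card F"
  then have "card F < card (K <+> L)"
    using assms by (simp add: card_Plus)
  from homogeneous_system_solvable[OF \<open>finite F\<close> _ this, of "\<lambda>i. case_sum (\<lambda>k. e k i) (\<lambda>l. f l i)"]
  obtain v where v: "\<exists>x\<in>K <+> L. v x \<noteq> 0"
    "\<And>i. i \<in> F \<Longrightarrow> (\<Sum>x\<in>K <+> L. case_sum (\<lambda>k. e k i) (\<lambda>l. f l i) x * v x) = 0"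
    using assms(2,3) by (metis finite_Plus)
  have "(\<forall>k\<in>K. v (Inl k) = 0) \<and> (\<forall>l\<in>L. - v (Inr l) = 0)"
  proof (rule triv)
    fix i assume "i \<in> F"
    with v(2)[of i] show "(\<Sum>k\<in>K. v (Inl k) * e k i) = (\<Sum>l\<in>L. - v (Inr l) * f l i)"
      using assms by (simp add: sum.Plus sum_negf mult.commute add_eq_0_iff2)
  qed
  with v(1) show False
    by auto
qed

text \<open>Together with \<open>v\<close> there are more vectors than sites, hence a linear relation; by independence
  it involves \<open>v\<close>.\<close>

lemma spanning_if_trivial_intersection:
  fixes e :: "'k \<Rightarrow> 'i \<Rightarrow> complex" and f :: "'l \<Rightarrow> 'i \<Rightarrow> complex"
  assumes "finite F" "finite K" "finite L" "card F \<le> card K + card L"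
    and triv: "\<And>c d. (\<And>i. i \<in> F \<Longrightarrow> (\<Sum>k\<in>K. c k * e k i) = (\<Sum>l\<in>L. d l * f l i))
      \<Longrightarrow> (\<forall>k\<in>K. c k = 0) \<and> (\<forall>l\<in>L. d l = 0)"
  obtains c d where "\<And>i. i \<in> F \<Longrightarrow> v i = (\<Sum>k\<in>K. c k * e k i) + (\<Sum>l\<in>L. d l * f l i)"
proof -
  let ?U = "{()} <+> (K <+> L)"
  let ?M = "\<lambda>i. case_sum (\<lambda>_. v i) (case_sum (\<lambda>k. e k i) (\<lambda>l. f l i))"
  have "card F < card ?U"
    using assms(1-4) by (simp add: card_Plus)
  moreover have "finite ?U"
    using assms(2,3) by simp
  ultimately obtain x where x: "\<exists>y\<in>?U. x y \<noteq> 0" "\<And>i. i \<in> F \<Longrightarrow> (\<Sum>y\<in>?U. ?M i y * x y) = 0"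
    using homogeneous_system_solvable[OF \<open>finite F\<close>, of ?U ?M] by blast
  define t where "t = x (Inl ())"
  define c where "c k = x (Inr (Inl k))" for k
  define d where "d l = x (Inr (Inr l))" for l
  have eq: "v i * t + (\<Sum>k\<in>K. c k * e k i) + (\<Sum>l\<in>L. d l * f l i) = 0" if "i \<in> F" for i
    using x(2)[OF that] assms(2,3)
    by (simp add: sum.Plus t_def c_def d_def mult.commute add.assoc)
  have "t \<noteq> 0"
  proof
    assume "t = 0"
    have "(\<forall>k\<in>K. c k = 0) \<and> (\<forall>l\<in>L. - d l = 0)"
      using eq \<open>t = 0\<close> by (intro triv) (simp add: sum_negf add_eq_0_iff2)
    with \<open>t = 0\<close> x(1) show False
      by (auto simp: t_def c_def d_def)
  qed
  show thesis
  proof (rule that[of "\<lambda>k. - c k / t" "\<lambda>l. - d l / t"])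
    fix i assume "i \<in> F"
    have "(\<Sum>k\<in>K. - c k / t * e k i) + (\<Sum>l\<in>L. - d l / t * f l i)
        = - ((\<Sum>k\<in>K. c k * e k i) + (\<Sum>l\<in>L. d l * f l i)) / t"
      by (simp add: sum_negf sum_divide_distrib add_divide_distrib diff_divide_distrib)
    also have "(\<Sum>k\<in>K. c k * e k i) + (\<Sum>l\<in>L. d l * f l i) = - (v i * t)"
      using eq[OF \<open>i \<in> F\<close>] by (simp only: eq_neg_iff_add_eq_0 ac_simps)
    also have "- (- (v i * t)) / t = v i"
      using \<open>t \<noteq> 0\<close> by simp
    finally show "v i = (\<Sum>k\<in>K. - c k / t * e k i) + (\<Sum>l\<in>L. - d l / t * f l i)"
      by simp
  qed
qed

definition sqnorm :: "'i set \<Rightarrow> ('i \<Rightarrow> complex) \<Rightarrow> real" where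
  "sqnorm F v = (\<Sum>i\<in>F. (cmod (v i))\<^sup>2)"

lemma sqnorm_nonneg: "0 \<le> sqnorm F v"
  by (simp add: sqnorm_def sum_nonneg)

lemma sqnorm_eigencombination:
  assumes "orthonormal F B e" "finite B" "K \<subseteq> B"
    and v: "\<And>i. i \<in> F \<Longrightarrow> v i = (\<Sum>k\<in>K. c k * e k i)"
  shows "sqnorm F v = (\<Sum>k\<in>K. (cmod (c k))\<^sup>2)"
proof -
  have K: "finite K" using assms finite_subset by blast
  have on: "sprod F (e k) (e l) = (if k = l then 1 else 0)" if "k \<in> K" "l \<in> K" for k l
    using assms(1) subsetD[OF assms(3)] that unfolding orthonormal_def by blast
  have "of_real (sqnorm F v) = sprod F v v"
    by (simp add: sprod_self sqnorm_def)
  also have "\<dots> = sprod F (\<lambda>i. \<Sum>k\<in>K. c k * e k i) (\<lambda>i. \<Sum>k\<in>K. c k * e k i)"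
    by (rule sprod_cong) (simp_all add: v)
  also have "\<dots> = (\<Sum>k\<in>K. c k * cnj (c k))"
    unfolding sprod_lincomb_left sprod_lincomb_right
    by (intro sum.cong refl) (simp add: on K if_distrib cong: if_cong)
  also have "\<dots> = of_real (\<Sum>k\<in>K. (cmod (c k))\<^sup>2)"
    by (simp add: complex_norm_square flip: of_real_power)
  finally show ?thesis
    by (simp only: of_real_eq_iff)
qed

lemma hform_eigencombination:
  assumes on: "orthonormal F B e" and "finite B" "K \<subseteq> B"
    and eig: "\<And>k i. k \<in> B \<Longrightarrow> i \<in> F \<Longrightarrow> mat_app F h (e k) i = of_real (lam k) * e k i"
    and v: "\<And>i. i \<in> F \<Longrightarrow> v i = (\<Sum>k\<in>K. c k * e k i)"
  shows "hform F h v = (\<Sum>k\<in>K. lam k * (cmod (c k))\<^sup>2)"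
proof -
  have K: "finite K" using assms finite_subset by blast
  have on: "sprod F (e k) (e l) = (if k = l then 1 else 0)" if "k \<in> K" "l \<in> K" for k l
    using assms(1) subsetD[OF assms(3)] that unfolding orthonormal_def by blast
  have "mat_app F h v i = (\<Sum>k\<in>K. (of_real (lam k) * c k) * e k i)" if "i \<in> F" for i
  proof -
    have "mat_app F h v i = mat_app F h (\<lambda>i. \<Sum>k\<in>K. c k * e k i) i"
      by (simp add: mat_app_def v)
    also have "\<dots> = (\<Sum>k\<in>K. (of_real (lam k) * c k) * e k i)"
      unfolding mat_app_lincomb using eig that \<open>K \<subseteq> B\<close>
      by (intro sum.cong refl) (auto simp: mult_ac)
    finally show ?thesis .
  qed
  then have "sprod F (mat_app F h v) v = sprod F (\<lambda>i. \<Sum>k\<in>K. (of_real (lam k) * c k) * e k i) (\<lambda>i. \<Sum>k\<in>K. c k * e k i)"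
    by (intro sprod_cong) (simp_all add: v)
  also have "\<dots> = (\<Sum>k\<in>K. of_real (lam k) * (c k * cnj (c k)))"
    unfolding sprod_lincomb_left sprod_lincomb_right
    by (intro sum.cong refl) (simp add: on K if_distrib mult_ac cong: if_cong)
  also have "\<dots> = of_real (\<Sum>k\<in>K. lam k * (cmod (c k))\<^sup>2)"
    by (simp add: complex_norm_square flip: of_real_power)
  finally show ?thesis
    by (simp add: hform_def del: of_real_sum)
qed

text \<open>Expand the unit vector at \<open>j\<close> in the basis: its coefficients are the \<open>cnj (e k j)\<close>.\<close>

lemma orthonormal_basis_complete:
  assumes "finite F" and on: "orthonormal F F e" and "i \<in> F" "j \<in> F"
  shows "(\<Sum>k\<in>F. e k i * cnj (e k j)) = (if i = j then 1 else 0)"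
proof -
  define v where "v = (\<lambda>i'. if i' = j then 1 else 0 :: complex)"
  obtain c d where c: "\<And>i. i \<in> F \<Longrightarrow> v i = (\<Sum>k\<in>F. c k * e k i) + (\<Sum>l\<in>({} :: 'a set). d l * e l i)"
  proof (rule spanning_if_trivial_intersection[of F F "{} :: 'a set" e e v])
    fix c d :: "'a \<Rightarrow> complex"
    assume *: "\<And>i. i \<in> F \<Longrightarrow> (\<Sum>k\<in>F. c k * e k i) = (\<Sum>l\<in>{}. d l * e l i)"
    have "sqnorm F (\<lambda>i. 0) = (\<Sum>k\<in>F. (cmod (c k))\<^sup>2)"
      by (rule sqnorm_eigencombination[OF on \<open>finite F\<close>]) (use * in auto)
    then show "(\<forall>k\<in>F. c k = 0) \<and> (\<forall>l\<in>{}. d l = 0)"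
      using \<open>finite F\<close> by (simp add: sqnorm_def sum_nonneg_eq_0_iff)
  qed (use \<open>finite F\<close> in auto)
  have "c k = cnj (e k j)" if "k \<in> F" for k
  proof -
    have "cnj (e k j) = sprod F v (e k)"
      using assms by (simp add: sprod_def v_def if_distrib[of "\<lambda>x. x * _"] cong: if_cong)
    also have "\<dots> = sprod F (\<lambda>i. \<Sum>k\<in>F. c k * e k i) (e k)"
      by (rule sprod_cong) (use c in auto)
    also have "\<dots> = (\<Sum>l\<in>F. c l * (if l = k then 1 else 0))"
      unfolding sprod_lincomb_left using on that by (intro sum.cong refl) (auto simp: orthonormal_def)
    also have "\<dots> = c k"
      using that \<open>finite F\<close> by (simp add: if_distrib cong: if_cong)
    finally show ?thesis by simp
  qed
  then show ?thesis
    using c[OF \<open>i \<in> F\<close>] by (simp add: v_def mult.commute)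
qed

lemma sum_eigenvalues_eq_trace:
  assumes "finite F" and on: "orthonormal F F e"
    and eig: "\<And>k i. k \<in> F \<Longrightarrow> i \<in> F \<Longrightarrow> mat_app F h (e k) i = of_real (lam k) * e k i"
  shows "(\<Sum>k\<in>F. lam k) = (\<Sum>i\<in>F. Re (h i i))"
proof -
  have "of_real (\<Sum>k\<in>F. lam k) = (\<Sum>k\<in>F. of_real (lam k) * sprod F (e k) (e k))"
    using on by (simp add: orthonormal_def)
  also have "\<dots> = (\<Sum>k\<in>F. \<Sum>i\<in>F. mat_app F h (e k) i * cnj (e k i))"
    by (simp add: sprod_def sum_distrib_left eig mult.assoc cong: sum.cong)
  also have "\<dots> = (\<Sum>i\<in>F. \<Sum>k\<in>F. \<Sum>j\<in>F. h i j * (e k j * cnj (e k i)))"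
    unfolding mat_app_def sum_distrib_right mult.assoc by (rule sum.swap)
  also have "\<dots> = (\<Sum>i\<in>F. \<Sum>j\<in>F. h i j * (\<Sum>k\<in>F. e k j * cnj (e k i)))"
    unfolding sum_distrib_left by (intro sum.cong refl sum.swap)
  also have "\<dots> = (\<Sum>i\<in>F. h i i)"
    using assms by (simp add: orthonormal_basis_complete if_distrib cong: sum.cong if_cong)
  finally have "Re (of_real (\<Sum>k\<in>F. lam k)) = Re (\<Sum>i\<in>F. h i i)"
    by simp
  then show ?thesis
    by simp
qed

section \<open>A splitting of the form outside a set of small measure\<close>

text \<open>The difference of the two counting functions is the sum over \<open>k\<close> of the indicator functions of
  \<open>{\<mu> k..b}\<close> minus those of \<open>{\<nu> k..b}\<close> for a common upper bound \<open>b\<close>, which gives its integral. Off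
  the values of \<open>\<mu>\<close> and \<open>\<nu>\<close> it is integer valued and nonnegative, so it dominates the indicator
  function of the set where it does not vanish.\<close>

lemma emeasure_counting_difference:
  fixes \<mu> \<nu> :: "'k \<Rightarrow> real"
  assumes "finite K"
    and le: "\<And>x. x \<notin> \<mu> ` K \<Longrightarrow> x \<notin> \<nu> ` K \<Longrightarrow> card {k\<in>K. \<nu> k < x} \<le> card {k\<in>K. \<mu> k < x}"
  obtains E where "E \<in> sets borel" "emeasure lborel E \<le> ennreal ((\<Sum>k\<in>K. \<nu> k) - (\<Sum>k\<in>K. \<mu> k))"
    "\<mu> ` K \<subseteq> E" "\<nu> ` K \<subseteq> E"
    "\<And>x. x \<notin> E \<Longrightarrow> card {k\<in>K. \<nu> k < x} = card {k\<in>K. \<mu> k < x}"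
proof -
  define X where "X = \<mu> ` K \<union> \<nu> ` K"
  have "finite X" using \<open>finite K\<close> by (simp add: X_def)
  then obtain b where b: "\<And>x. x \<in> X \<Longrightarrow> x \<le> b"
    using bdd_above_finite[OF \<open>finite X\<close>] unfolding bdd_above_def by blast
  define g where "g x = (\<Sum>k\<in>K. indicat_real {\<mu> k..b} x - indicat_real {\<nu> k..b} x)" for x
  have g_eq: "g x = real (card {k\<in>K. \<mu> k < x}) - real (card {k\<in>K. \<nu> k < x})" if "x \<notin> X" for x
  proof (cases "x \<le> b")
    case True
    have "g x = (\<Sum>k\<in>K. (if \<mu> k < x then 1 else 0) - (if \<nu> k < x then 1 else 0))"
      unfolding g_def
      by (intro sum.cong refl) (use True that in \<open>force simp: indicator_def X_def\<close>)
    also have "\<dots> = real (card {k\<in>K. \<mu> k < x}) - real (card {k\<in>K. \<nu> k < x})"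
      using \<open>finite K\<close> by (simp add: sum_subtractf flip: sum.inter_filter)
    finally show ?thesis .
  next
    case False
    then have "\<mu> k < x" "\<nu> k < x" if "k \<in> K" for k
      using b[of "\<mu> k"] b[of "\<nu> k"] that by (auto simp: X_def)
    then have "{k\<in>K. \<mu> k < x} = K" "{k\<in>K. \<nu> k < x} = K" by auto
    with False show ?thesis by (simp add: g_def)
  qed
  define S where "S = {x. x \<notin> X \<and> 1 \<le> g x}"
  have gm [measurable]: "g \<in> borel_measurable borel"
    unfolding g_def by measurable
  have Xm [measurable]: "X \<in> sets borel"
    using \<open>finite X\<close> by (simp add: finite_imp_closed borel_closed)
  have Sm [measurable]: "S \<in> sets borel"
    unfolding S_def by measurable
  have ii: "integrable lborel (indicat_real {y..b})" for y
    by (rule integrable_real_indicator) (auto simp: emeasure_lborel_Icc_eq)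
  have gi: "integrable lborel g"
    unfolding g_def by (intro Bochner_Integration.integrable_sum Bochner_Integration.integrable_diff ii)
  have "integral\<^sup>L lborel g = (\<Sum>k\<in>K. (b - \<mu> k) - (b - \<nu> k))"
    unfolding g_def
    by (subst Bochner_Integration.integral_sum, intro Bochner_Integration.integrable_diff ii,
        intro sum.cong refl, subst Bochner_Integration.integral_diff[OF ii ii])
      (use b in \<open>auto simp: X_def\<close>)
  then have int_g: "integral\<^sup>L lborel g = (\<Sum>k\<in>K. \<nu> k) - (\<Sum>k\<in>K. \<mu> k)"
    by (simp add: sum_subtractf)
  have nonneg: "0 \<le> g x" if "x \<notin> X" for x
    using g_eq[OF that] le[of x] that by (simp add: X_def)
  have Xnull: "AE x in lborel. x \<notin> X"
    using \<open>finite X\<close> by (intro AE_not_in countable_imp_null_set_lborel countable_finite)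
  have "emeasure lborel S = (\<integral>\<^sup>+ x. indicator S x \<partial>lborel)"
    by simp
  also have "\<dots> \<le> (\<integral>\<^sup>+ x. ennreal (g x) \<partial>lborel)"
  proof (rule nn_integral_mono_AE)
    show "AE x in lborel. indicator S x \<le> ennreal (g x)"
      using Xnull by eventually_elim (auto simp: S_def indicator_def ennreal_ge_1)
  qed
  also have "\<dots> = ennreal (integral\<^sup>L lborel g)"
    using Xnull nonneg by (intro nn_integral_eq_integral[OF gi]) (auto elim: eventually_mono)
  finally have S: "emeasure lborel S \<le> ennreal ((\<Sum>k\<in>K. \<nu> k) - (\<Sum>k\<in>K. \<mu> k))"
    by (simp add: int_g)
  show thesis
  proof (rule that[of "S \<union> X"])
    show "emeasure lborel (S \<union> X) \<le> ennreal ((\<Sum>k\<in>K. \<nu> k) - (\<Sum>k\<in>K. \<mu> k))"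
      using S \<open>finite X\<close>
      by (subst emeasure_Un_null_set) (auto intro: countable_imp_null_set_lborel countable_finite)
    fix x assume x: "x \<notin> S \<union> X"
    then have "g x < 1" by (auto simp: S_def)
    then have "real (card {k\<in>K. \<mu> k < x}) - real (card {k\<in>K. \<nu> k < x}) < 1"
      using g_eq[of x] x by auto
    then show "card {k\<in>K. \<nu> k < x} = card {k\<in>K. \<mu> k < x}"
      using le[of x] x by (auto simp: X_def)
  qed (auto simp: X_def[symmetric], auto simp: X_def)
qed

lemma finite_gap:
  fixes x :: real
  assumes "finite X" "x \<notin> X"
  obtains \<delta> where "\<delta> > 0" "\<And>y. y \<in> X \<Longrightarrow> y \<le> x - \<delta> \<or> x + \<delta> \<le> y"
proof -
  obtain \<delta> where "\<delta> > 0" and \<delta>: "\<And>y. y \<in> X \<Longrightarrow> y \<noteq> x \<Longrightarrow> \<delta> \<le> dist x y"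
    using finite_set_avoid[OF \<open>finite X\<close>, of x] by (metis)
  show thesis
  proof (rule that[OF \<open>\<delta> > 0\<close>])
    fix y assume "y \<in> X"
    then have "\<delta> \<le> \<bar>x - y\<bar>"
      using \<delta> assms(2) by (metis dist_real_def)
    then show "y \<le> x - \<delta> \<or> x + \<delta> \<le> y"
      by linarith
  qed
qed

text \<open>The exceptional set \<open>E\<close> consists of the eigenvalues and of the \<open>x\<close> for which more eigenvalues of
  \<open>hm\<close> than of \<open>hp\<close> lie below \<open>x\<close>. Outside \<open>E\<close> the space is the direct sum of a space where \<open>hp\<close> is
  below \<open>x\<close> and one where \<open>hm\<close> is above \<open>x\<close>; the matrix \<open>P\<close> projects onto the first along the
  second. Expressing the projection as a matrix allows it to be applied in every cell of an
  infinite lattice.\<close>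

lemma form_splitting_off_small_set:
  assumes "finite F" and hm: "hermitian_on F hm" and hp: "hermitian_on F hp"
    and le: "\<And>v. hform F hm v \<le> hform F hp v"
  obtains E where "E \<in> sets borel"
    "emeasure lborel E \<le> ennreal (\<Sum>i\<in>F. Re (hp i i) - Re (hm i i))"
    "\<And>x. x \<notin> E \<Longrightarrow> \<exists>\<delta>>0. \<exists>P. \<forall>u v w. (\<forall>i\<in>F. v i = mat_app F P u i) \<longrightarrow> (\<forall>i\<in>F. w i = u i - v i) \<longrightarrow>
        hform F hp v \<le> (x - \<delta>) * sqnorm F v \<and> (x + \<delta>) * sqnorm F w \<le> hform F hm w"
proof -
  obtain e \<nu> where e: "orthonormal F F e"
    and \<nu>: "\<And>k i. k \<in> F \<Longrightarrow> i \<in> F \<Longrightarrow> mat_app F hp (e k) i = of_real (\<nu> k) * e k i"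
    using hermitian_eigenbasis[OF \<open>finite F\<close> hp] by blast
  obtain f \<mu> where f: "orthonormal F F f"
    and \<mu>: "\<And>k i. k \<in> F \<Longrightarrow> i \<in> F \<Longrightarrow> mat_app F hm (f k) i = of_real (\<mu> k) * f k i"
    using hermitian_eigenbasis[OF \<open>finite F\<close> hm] by blast
  define K where "K x = {k\<in>F. \<nu> k < x}" for x
  define L where "L x = {k\<in>F. x < \<mu> k}" for x
  have KL: "K x \<subseteq> F" "L x \<subseteq> F" "finite (K x)" "finite (L x)" for x
    using \<open>finite F\<close> by (auto simp: K_def L_def)
  have upper: "hform F hp v \<le> y * sqnorm F v"
    if "\<And>i. i \<in> F \<Longrightarrow> v i = (\<Sum>k\<in>K x. c k * e k i)" "\<And>k. k \<in> K x \<Longrightarrow> \<nu> k \<le> y" for x y v c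
  proof -
    have "hform F hp v = (\<Sum>k\<in>K x. \<nu> k * (cmod (c k))\<^sup>2)"
      by (rule hform_eigencombination[OF e \<open>finite F\<close> KL(1)]) (use \<nu> that in auto)
    moreover have "sqnorm F v = (\<Sum>k\<in>K x. (cmod (c k))\<^sup>2)"
      by (rule sqnorm_eigencombination[OF e \<open>finite F\<close> KL(1)]) (use that in auto)
    ultimately show ?thesis
      using that(2) by (auto simp: sum_distrib_left intro!: sum_mono mult_right_mono)
  qed
  have lower: "y * sqnorm F v \<le> hform F hm v"
    if "\<And>i. i \<in> F \<Longrightarrow> v i = (\<Sum>k\<in>L x. c k * f k i)" "\<And>k. k \<in> L x \<Longrightarrow> y \<le> \<mu> k" for x y v c
  proof -
    have "hform F hm v = (\<Sum>k\<in>L x. \<mu> k * (cmod (c k))\<^sup>2)"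
      by (rule hform_eigencombination[OF f \<open>finite F\<close> KL(2)]) (use \<mu> that in auto)
    moreover have "sqnorm F v = (\<Sum>k\<in>L x. (cmod (c k))\<^sup>2)"
      by (rule sqnorm_eigencombination[OF f \<open>finite F\<close> KL(2)]) (use that in auto)
    ultimately show ?thesis
      using that(2) by (auto simp: sum_distrib_left intro!: sum_mono mult_right_mono)
  qed
  have gap: "\<exists>\<delta>>0. (\<forall>k\<in>K x. \<nu> k \<le> x - \<delta>) \<and> (\<forall>k\<in>L x. x + \<delta> \<le> \<mu> k)"
    if x: "x \<notin> \<mu> ` F" "x \<notin> \<nu> ` F" for x
  proof -
    obtain \<delta> where "\<delta> > 0" "\<And>y. y \<in> \<mu> ` F \<union> \<nu> ` F \<Longrightarrow> y \<le> x - \<delta> \<or> x + \<delta> \<le> y"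
      using finite_gap[of "\<mu> ` F \<union> \<nu> ` F" x] x \<open>finite F\<close> by blast
    then show ?thesis
      by (intro exI[of _ \<delta>]) (force simp: K_def L_def)
  qed
  \<comment> \<open>On the common vectors \<open>hm\<close> exceeds \<open>x\<close> while \<open>hp\<close> stays below \<open>x\<close>.\<close>
  have triv: "(\<forall>k\<in>K x. c k = 0) \<and> (\<forall>l\<in>L x. d l = 0)"
    if x: "x \<notin> \<mu> ` F" "x \<notin> \<nu> ` F"
      and eq: "\<And>i. i \<in> F \<Longrightarrow> (\<Sum>k\<in>K x. c k * e k i) = (\<Sum>l\<in>L x. d l * f l i)" for x c d
  proof -
    obtain \<delta> where \<delta>: "\<delta> > 0" "\<And>k. k \<in> K x \<Longrightarrow> \<nu> k \<le> x - \<delta>" "\<And>k. k \<in> L x \<Longrightarrow> x + \<delta> \<le> \<mu> k"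
      using gap[OF x] by auto
    define v where "v i = (\<Sum>k\<in>K x. c k * e k i)" for i
    have v1: "\<And>i. i \<in> F \<Longrightarrow> v i = (\<Sum>k\<in>K x. c k * e k i)"
      and v2: "\<And>i. i \<in> F \<Longrightarrow> v i = (\<Sum>l\<in>L x. d l * f l i)"
      using eq by (auto simp: v_def)
    have "(x + \<delta>) * sqnorm F v \<le> (x - \<delta>) * sqnorm F v"
      using upper[OF v1 \<delta>(2)] lower[OF v2 \<delta>(3)] le[of v] by linarith
    then have "\<delta> * sqnorm F v \<le> 0"
      by (simp add: algebra_simps)
    then have "sqnorm F v = 0"
      using \<open>\<delta> > 0\<close> sqnorm_nonneg[of F v] by (simp add: mult_le_0_iff)
    then show ?thesis
      using sqnorm_eigencombination[OF e \<open>finite F\<close> KL(1) v1]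
        sqnorm_eigencombination[OF f \<open>finite F\<close> KL(2) v2] KL(3,4)[of x]
      by (simp add: sum_nonneg_eq_0_iff)
  qed
  have cardL: "card (L x) + card {k\<in>F. \<mu> k < x} = card F" if "x \<notin> \<mu> ` F" for x
  proof -
    have "F = L x \<union> {k\<in>F. \<mu> k < x}"
      using that by (auto simp: L_def)
    moreover have "L x \<inter> {k\<in>F. \<mu> k < x} = {}"
      by (auto simp: L_def)
    ultimately show ?thesis
      using \<open>finite F\<close> card_Un_disjoint[of "L x" "{k\<in>F. \<mu> k < x}"] KL(4)[of x] by simp
  qed
  obtain E where E: "E \<in> sets borel" "emeasure lborel E \<le> ennreal ((\<Sum>k\<in>F. \<nu> k) - (\<Sum>k\<in>F. \<mu> k))"
    "\<mu> ` F \<subseteq> E" "\<nu> ` F \<subseteq> E"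
    "\<And>x. x \<notin> E \<Longrightarrow> card {k\<in>F. \<nu> k < x} = card {k\<in>F. \<mu> k < x}"
  proof (rule emeasure_counting_difference[of F \<mu> \<nu>])
    fix x assume x: "x \<notin> \<mu> ` F" "x \<notin> \<nu> ` F"
    have "card (K x) + card (L x) \<le> card F"
      by (rule card_add_le_if_trivial_intersection[of F "K x" "L x" e f,
            OF \<open>finite F\<close> KL(3,4) triv[OF x]])
    then show "card {k\<in>F. \<nu> k < x} \<le> card {k\<in>F. \<mu> k < x}"
      using cardL[OF x(1)] by (simp add: K_def)
  qed (use \<open>finite F\<close> in auto)
  show thesis
  proof (rule that[OF E(1)])
    show "emeasure lborel E \<le> ennreal (\<Sum>i\<in>F. Re (hp i i) - Re (hm i i))"
      using E(2) sum_eigenvalues_eq_trace[OF \<open>finite F\<close> e \<nu>]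
        sum_eigenvalues_eq_trace[OF \<open>finite F\<close> f \<mu>] by (simp add: sum_subtractf)
    fix x assume "x \<notin> E"
    then have x: "x \<notin> \<mu> ` F" "x \<notin> \<nu> ` F"
      using E(3,4) by auto
    obtain \<delta> where \<delta>: "\<delta> > 0" "\<And>k. k \<in> K x \<Longrightarrow> \<nu> k \<le> x - \<delta>" "\<And>k. k \<in> L x \<Longrightarrow> x + \<delta> \<le> \<mu> k"
      using gap[OF x] by auto
    have cardKL: "card F \<le> card (K x) + card (L x)"
      using cardL[OF x(1)] E(5)[OF \<open>x \<notin> E\<close>] by (simp add: K_def)
    have "\<exists>c d. \<forall>i\<in>F. (if i = j then 1 else 0) = (\<Sum>k\<in>K x. c k * e k i) + (\<Sum>l\<in>L x. d l * f l i)" for j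
    proof (rule spanning_if_trivial_intersection[of F "K x" "L x" e f "\<lambda>i. if i = j then 1 else 0",
          OF \<open>finite F\<close> KL(3,4) cardKL triv[OF x]])
      fix c d :: "'a \<Rightarrow> complex"
      assume "\<And>i. i \<in> F \<Longrightarrow>
          (if i = j then 1 else 0) = (\<Sum>k\<in>K x. c k * e k i) + (\<Sum>l\<in>L x. d l * f l i)"
      then show ?thesis
        by (intro exI[of _ c] exI[of _ d] ballI)
    qed
    then obtain c d where cd: "\<And>i j. i \<in> F \<Longrightarrow>
        (if i = j then 1 else 0) = (\<Sum>k\<in>K x. c j k * e k i) + (\<Sum>l\<in>L x. d j l * f l i)"
      by metis
    \<comment> \<open>Column \<open>j\<close> of \<open>P\<close> is the first component of the unit vector at \<open>j\<close>.\<close>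
    define P where "P i j = (\<Sum>k\<in>K x. c j k * e k i)" for i j
    show "\<exists>\<delta>>0. \<exists>P. \<forall>u v w. (\<forall>i\<in>F. v i = mat_app F P u i) \<longrightarrow> (\<forall>i\<in>F. w i = u i - v i) \<longrightarrow>
        hform F hp v \<le> (x - \<delta>) * sqnorm F v \<and> (x + \<delta>) * sqnorm F w \<le> hform F hm w"
    proof (intro exI[of _ \<delta>] exI[of _ P] conjI allI impI \<delta>(1))
      fix u v w
      assume v: "\<forall>i\<in>F. v i = mat_app F P u i" and w: "\<forall>i\<in>F. w i = u i - v i"
      have v1: "v i = (\<Sum>k\<in>K x. (\<Sum>j\<in>F. c j k * u j) * e k i)" if "i \<in> F" for i
        using v that by (simp add: mat_app_def P_def sum_distrib_left sum_distrib_right mult_ac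
            sum.swap[of _ F "K x"])
      have w1: "w i = (\<Sum>l\<in>L x. (\<Sum>j\<in>F. d j l * u j) * f l i)" if "i \<in> F" for i
      proof -
        have "u i = (\<Sum>j\<in>F. (if i = j then 1 else 0) * u j)"
          using that \<open>finite F\<close> by (simp add: if_distrib[of "\<lambda>z. z * _"] cong: if_cong)
        also have "\<dots> = (\<Sum>j\<in>F. P i j * u j) + (\<Sum>j\<in>F. (\<Sum>l\<in>L x. d j l * f l i) * u j)"
          unfolding cd[OF that] P_def by (simp add: distrib_right sum.distrib)
        also have "(\<Sum>j\<in>F. P i j * u j) = v i"
          using v that by (simp add: mat_app_def)
        finally show ?thesis
          using w that by (simp add: sum_distrib_left sum_distrib_right mult_ac
            sum.swap[of _ F "L x"])
      qed
      show "hform F hp v \<le> (x - \<delta>) * sqnorm F v"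
        by (rule upper[OF v1 \<delta>(2)])
      show "(x + \<delta>) * sqnorm F w \<le> hform F hm w"
        by (rule lower[OF w1 \<delta>(3)])
    qed
  qed
qed

section \<open>Shifts, multiplications and edges\<close>

lift_definition shift :: "'i::ab_group_add \<Rightarrow> 'i ell2 \<Rightarrow> 'i ell2" is "\<lambda>s f i. f (i + s)"
proof -
  fix s :: 'i and f :: "'i \<Rightarrow> complex"
  assume "(\<lambda>i. (cmod (f i))\<^sup>2) summable_on UNIV"
  moreover have "bij_betw (\<lambda>i. i + s) UNIV UNIV"
    by (rule bij_plus_right)
  ultimately show "(\<lambda>i. (cmod (f (i + s)))\<^sup>2) summable_on UNIV"
    using summable_on_reindex_bij_betw[of "\<lambda>i. i + s" UNIV UNIV "\<lambda>i. (cmod (f i))\<^sup>2"] by simp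
qed

text \<open>Multiplication by an unbounded function does not map the space to itself; it is replaced by
  \<open>0\<close>.\<close>

lift_definition mult_op :: "('i \<Rightarrow> complex) \<Rightarrow> 'i ell2 \<Rightarrow> 'i ell2"
  is "\<lambda>g f i. if bounded (range g) then g i * f i else 0"
proof -
  fix g f :: "'i \<Rightarrow> complex"
  assume f: "(\<lambda>i. (cmod (f i))\<^sup>2) summable_on UNIV"
  show "(\<lambda>i. (cmod (if bounded (range g) then g i * f i else 0))\<^sup>2) summable_on UNIV"
  proof (cases "bounded (range g)")
    case True
    then obtain B where B: "\<And>i. cmod (g i) \<le> B"
      by (auto simp: bounded_iff)
    have "(\<lambda>i. B\<^sup>2 * (cmod (f i))\<^sup>2) summable_on UNIV"
      by (rule summable_on_cmult_right[OF f])
    then show ?thesis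
      by (rule summable_on_comparison_test)
        (use True B in \<open>auto simp: norm_mult power_mult_distrib intro!: mult_right_mono power_mono\<close>)
  qed simp
qed

lemma coord_shift [simp]: "coord (shift s u) i = coord u (i + s)"
  by (simp add: shift.rep_eq)

lemma coord_mult_op [simp]: "bounded (range g) \<Longrightarrow> coord (mult_op g u) i = g i * coord u i"
  by (simp add: mult_op.rep_eq)

lemma inner_shift: "inner (shift s u) v = inner u (shift (- s) v)"
proof -
  have "inner u (shift (- s) v) = (\<Sum>\<^sub>\<infinity>i. inner (coord u i) (coord v (i - s)))"
    by (simp add: inner_ell2_def)
  also have "\<dots> = (\<Sum>\<^sub>\<infinity>i. inner (coord u (i + s)) (coord v (i + s - s)))"
    by (rule infsum_reindex_bij_betw[symmetric], rule bij_plus_right)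
  finally show ?thesis
    by (simp add: inner_ell2_def)
qed

lemma norm_shift [simp]: "norm (shift s u) = norm u"
proof -
  have "shift (- s) (shift s u) = u"
    by (rule ell2_eqI) simp
  then show ?thesis
    by (simp add: norm_eq_sqrt_inner inner_shift)
qed

lemma bounded_linear_shift: "bounded_linear (shift s)"
  by (rule bounded_linear_intro[where K = 1]) (auto intro!: ell2_eqI)

lemma norm_mult_op_le:
  assumes "\<And>i. cmod (g i) \<le> B"
  shows "norm (mult_op g u) \<le> norm u * B"
proof (rule norm_ell2_le)
  have b: "bounded (range g)"
    using assms by (auto simp: bounded_iff)
  have "0 \<le> B" using assms norm_ge_zero order_trans by blast
  then show "0 \<le> norm u * B" by simp
  fix A :: "'a set" assume "finite A"
  have "(\<Sum>i\<in>A. (cmod (coord (mult_op g u) i))\<^sup>2) \<le> (\<Sum>i\<in>A. (cmod (coord u i))\<^sup>2 * B\<^sup>2)"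
    using b assms by (intro sum_mono)
      (auto simp: norm_mult power_mult_distrib mult.commute intro!: mult_right_mono power_mono)
  also have "\<dots> \<le> (norm u * B)\<^sup>2"
    using sum_coord_le_norm[OF \<open>finite A\<close>, of u]
    by (simp add: power_mult_distrib mult_right_mono flip: sum_distrib_right)
  finally show "(\<Sum>i\<in>A. (cmod (coord (mult_op g u) i))\<^sup>2) \<le> (norm u * B)\<^sup>2" .
qed

lemma bounded_linear_mult_op:
  assumes "bounded (range g)"
  shows "bounded_linear (mult_op g)"
proof -
  obtain B where B: "\<And>i. cmod (g i) \<le> B"
    using assms by (auto simp: bounded_iff)
  show ?thesis
    by (rule bounded_linear_intro[where K = B])
      (auto intro!: ell2_eqI norm_mult_op_le B simp: assms distrib_left)
qed

lemma inner_mult_op: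
  assumes "bounded (range g)"
  shows "inner (mult_op g u) v = inner u (mult_op (\<lambda>i. cnj (g i)) v)"
proof -
  have "bounded (range (\<lambda>i. cnj (g i)))"
    using assms by (simp add: bounded_iff)
  then show ?thesis
    using assms by (simp add: inner_ell2_def) (simp add: inner_complex_def algebra_simps)
qed

text \<open>The selfadjoint operator of all edges from \<open>i\<close> to \<open>i + s\<close>, where the edge at \<open>i\<close> has weight
  \<open>g i\<close>.\<close>

definition edge_op :: "('i \<Rightarrow> complex) \<Rightarrow> 'i::ab_group_add \<Rightarrow> 'i ell2 \<Rightarrow> 'i ell2" where
  "edge_op g s u = mult_op g (shift s u) + shift (- s) (mult_op (\<lambda>i. cnj (g i)) u)"

lemma coord_edge_op:
  assumes "bounded (range g)"
  shows "coord (edge_op g s u) i = g i * coord u (i + s) + cnj (g (i - s)) * coord u (i - s)"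
proof -
  have "bounded (range (\<lambda>i. cnj (g i)))"
    using assms by (simp add: bounded_iff)
  then show ?thesis
    using assms by (simp add: edge_op_def)
qed

lemma bounded_linear_edge_op:
  assumes "bounded (range g)"
  shows "bounded_linear (edge_op g s)"
proof -
  have "bounded (range (\<lambda>i. cnj (g i)))"
    using assms by (simp add: bounded_iff)
  then have "bounded_linear (\<lambda>u. mult_op g (shift s u) + shift (- s) (mult_op (\<lambda>i. cnj (g i)) u))"
    using assms
    by (intro bounded_linear_add bounded_linear_compose[OF bounded_linear_mult_op bounded_linear_shift]
        bounded_linear_compose[OF bounded_linear_shift bounded_linear_mult_op])
  then show ?thesis
    by (simp add: edge_op_def[abs_def])
qed

lemma inner_edge_op:
  assumes "bounded (range g)"
  shows "inner (edge_op g s u) v = inner (mult_op g (shift s u)) v + inner u (mult_op g (shift s v))"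
proof -
  have "bounded (range (\<lambda>i. cnj (g i)))"
    using assms by (simp add: bounded_iff)
  then show ?thesis
    by (simp add: edge_op_def inner_add_left inner_shift[of "- s"] inner_mult_op)
qed

lemma edge_op_sym:
  assumes "bounded (range g)"
  shows "inner (edge_op g s u) v = inner u (edge_op g s v)"
  using inner_edge_op[OF assms, of s u v] inner_edge_op[OF assms, of s v u]
  by (simp add: inner_commute)

text \<open>Pointwise this is \<open>2 \<bar>g i x y\<bar> \<le> \<bar>g i\<bar> (\<bar>x\<bar>\<^sup>2 + \<bar>y\<bar>\<^sup>2)\<close> at the two ends of the edge; the contribution of
  the far end is moved to its own site by a shift.\<close>

lemma abs_inner_edge_op_le:
  assumes g: "bounded (range g)"
  shows "\<bar>inner (edge_op g s v) v\<bar>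
    \<le> inner (mult_op (\<lambda>i. of_real (cmod (g i) + cmod (g (i - s)))) v) v"
proof -
  let ?n = "\<lambda>i. complex_of_real (cmod (g i))" and ?n' = "\<lambda>i. complex_of_real (cmod (g (i - s)))"
  have b: "bounded (range ?n)" "bounded (range ?n')"
    "bounded (range (\<lambda>i. of_real (cmod (g i) + cmod (g (i - s))) :: complex))"
  proof -
    obtain B where B: "\<And>i. cmod (g i) \<le> B"
      using g by (auto simp: bounded_iff)
    show "bounded (range ?n)" "bounded (range ?n')"
      using B by (auto simp: bounded_iff)
    have "cmod (of_real (cmod (g i) + cmod (g (i - s)))) \<le> 2 * B" for i
      using B[of i] B[of "i - s"] by (simp add: norm_of_real del: of_real_add)
    then show "bounded (range (\<lambda>i. of_real (cmod (g i) + cmod (g (i - s))) :: complex))"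
      by (auto simp: bounded_iff simp del: of_real_add)
  qed
  have pt: "2 * \<bar>inner (g i * x) y\<bar> \<le> inner (?n i * x) x + inner (?n i * y) y" for i x y
  proof -
    have "2 * \<bar>inner (g i * x) y\<bar> \<le> 2 * (cmod (g i * x) * cmod y)"
      using Cauchy_Schwarz_ineq2[of "g i * x" y] by simp
    also have "\<dots> = cmod (g i) * (2 * cmod x * cmod y)"
      by (simp add: norm_mult)
    also have "\<dots> \<le> cmod (g i) * ((cmod x)\<^sup>2 + (cmod y)\<^sup>2)"
      by (intro mult_left_mono sum_squares_bound norm_ge_zero)
    also have "\<dots> = inner (?n i * x) x + inner (?n i * y) y"
      by (simp add: power2_norm_eq_inner distrib_left flip: scaleR_conv_of_real)
    finally show ?thesis .
  qed
  have "\<bar>inner (edge_op g s v) v\<bar> = 2 * \<bar>inner (mult_op g (shift s v)) v\<bar>"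
    unfolding inner_edge_op[OF g] inner_commute[of v] by simp
  also have "\<dots> \<le> inner (mult_op ?n (shift s v)) (shift s v) + inner (mult_op ?n v) v"
  proof -
    let ?f = "\<lambda>i. inner (coord (mult_op g (shift s v)) i) (coord v i)"
    let ?G = "\<lambda>i. inner (coord (mult_op ?n (shift s v)) i) (coord (shift s v) i)
          + inner (coord (mult_op ?n v) i) (coord v i)"
    have G: "?G summable_on UNIV"
      by (intro summable_on_add summable_inner_coord)
    have eq: "infsum ?G UNIV = inner (mult_op ?n (shift s v)) (shift s v) + inner (mult_op ?n v) v"
      unfolding inner_ell2_def by (intro infsum_add summable_inner_coord)
    have fG: "2 * ?f i \<le> ?G i" "- 2 * ?f i \<le> ?G i" for i
      using pt[of i "coord (shift s v) i" "coord v i"]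
      by (simp_all only: coord_mult_op[OF g] coord_mult_op[OF b(1)])
    have "infsum (\<lambda>i. 2 * ?f i) UNIV \<le> infsum ?G UNIV"
      by (intro infsum_mono G summable_on_cmult_right summable_inner_coord fG)
    moreover have "infsum (\<lambda>i. - 2 * ?f i) UNIV \<le> infsum ?G UNIV"
      by (intro infsum_mono G summable_on_cmult_right summable_inner_coord fG)
    ultimately show ?thesis
      unfolding eq by (simp only: infsum_cmult_right' flip: inner_ell2_def)
  qed
  also have "inner (mult_op ?n (shift s v)) (shift s v) = inner (mult_op ?n' v) v"
  proof -
    have "mult_op ?n' v = shift (- s) (mult_op ?n (shift s v))"
      using b by (intro ell2_eqI) simp
    then show ?thesis
      by (simp add: inner_shift[of "- s"])
  qed
  also have "inner (mult_op ?n' v) v + inner (mult_op ?n v) v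
    = inner (mult_op (\<lambda>i. of_real (cmod (g i) + cmod (g (i - s)))) v) v"
  proof -
    have "mult_op (\<lambda>i. of_real (cmod (g i) + cmod (g (i - s)))) v = mult_op ?n' v + mult_op ?n v"
      by (rule ell2_eqI, unfold coord_simps coord_mult_op[OF b(1)] coord_mult_op[OF b(2)]
          coord_mult_op[OF b(3)]) (simp add: distrib_right)
    then show ?thesis
      by (simp add: inner_add_left)
  qed
  finally show ?thesis .
qed

section \<open>Tilings of the index group by finite cells\<close>

text \<open>\<open>T\<close> is a subgroup of translations with the finite fundamental domain \<open>F\<close>.\<close>

locale cell_tiling =
  fixes T F :: "'i::ab_group_add set"
  assumes finite_cell: "finite F"
    and zero_translation: "0 \<in> T"
    and diff_translation: "s \<in> T \<Longrightarrow> t \<in> T \<Longrightarrow> s - t \<in> T"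
    and tiling: "bij_betw (\<lambda>(t, f). t + f) (T \<times> F) UNIV"
begin

definition base :: "'i \<Rightarrow> 'i" where
  "base i = fst (the_inv_into (T \<times> F) (\<lambda>(t, f). t + f) i)"

definition site :: "'i \<Rightarrow> 'i" where
  "site i = snd (the_inv_into (T \<times> F) (\<lambda>(t, f). t + f) i)"

lemma base_site: "base i \<in> T" "site i \<in> F" "base i + site i = i"
proof -
  let ?p = "the_inv_into (T \<times> F) (\<lambda>(t, f). t + f) i"
  have "i \<in> (\<lambda>(t, f). t + f) ` (T \<times> F)"
    using tiling by (simp add: bij_betw_def)
  then have "?p \<in> T \<times> F" "(case ?p of (t, f) \<Rightarrow> t + f) = i"
    using tiling by (auto simp: bij_betw_def intro!: the_inv_into_into f_the_inv_into_f)
  then show "base i \<in> T" "site i \<in> F" "base i + site i = i"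
    by (auto simp: base_def site_def split: prod.splits)
qed

lemma base_site_unique:
  assumes "t \<in> T" "f \<in> F"
  shows "base (t + f) = t" "site (t + f) = f"
proof -
  have "the_inv_into (T \<times> F) (\<lambda>(t, f). t + f) ((\<lambda>(t, f). t + f) (t, f)) = (t, f)"
    using tiling assms by (intro the_inv_into_f_f) (auto simp: bij_betw_def)
  then show "base (t + f) = t" "site (t + f) = f"
    by (simp_all add: base_def site_def)
qed

lemma add_translation: "s \<in> T \<Longrightarrow> t \<in> T \<Longrightarrow> s + t \<in> T"
  using diff_translation[OF _ diff_translation[OF zero_translation]] by fastforce

lemma base_site_translate:
  assumes "t \<in> T"
  shows "base (t + i) = t + base i" "site (t + i) = site i"
proof -
  have "t + i = (t + base i) + site i"
    using base_site(3)[of i] by (simp add: add.assoc)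
  then show "base (t + i) = t + base i" "site (t + i) = site i"
    using base_site_unique[OF add_translation[OF assms base_site(1)] base_site(2)] by metis+
qed

lemma base_cell [simp]: "f \<in> F \<Longrightarrow> base f = 0" and site_cell [simp]: "f \<in> F \<Longrightarrow> site f = f"
  using base_site_unique[OF zero_translation] by simp_all

lemma mem_cell_iff: "i \<in> F \<longleftrightarrow> base i = 0"
  using base_site[of i] by auto

definition periodic :: "('i \<Rightarrow> 'b) \<Rightarrow> bool" where
  "periodic g \<longleftrightarrow> (\<forall>t\<in>T. \<forall>i. g (t + i) = g i)"

lemma periodic_site: "periodic g \<Longrightarrow> g (site i) = g i"
  using base_site[of i] unfolding periodic_def by metis

lemma periodic_bounded:
  fixes g :: "'i \<Rightarrow> 'b::real_normed_vector"
  assumes "periodic g"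
  shows "bounded (range g)"
proof -
  have "range g \<subseteq> g ` F"
    using periodic_site[OF assms] base_site(2) by (metis image_subsetI imageI)
  then show ?thesis
    using finite_cell by (meson bounded_subset finite_imageI finite_imp_bounded)
qed

text \<open>Both sides sum \<open>g\<close> over a fundamental domain.\<close>

lemma sum_periodic_shift:
  assumes "periodic g"
  shows "(\<Sum>f\<in>F. g (f - s)) = (\<Sum>f\<in>F. g f)"
proof (rule sum.reindex_bij_witness[of F "\<lambda>f. site (f + s)" "\<lambda>f. site (f - s)"])
  have inv: "site (site (f + x) - x) = f" if "f \<in> F" for f x
  proof -
    have "f = base (f + x) + (site (f + x) - x)"
      using base_site(3)[of "f + x"] by (simp add: algebra_simps)
    then show ?thesis
      using base_site_translate(2)[OF base_site(1)] site_cell[OF that] by metis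
  qed
  show "site (site (f - s) + s) = f" if "f \<in> F" for f
    using inv[OF that, of "- s"] by simp
  show "site (site (f + s) - s) = f" if "f \<in> F" for f
    using inv[OF that, of s] by simp
  show "g (site (f - s)) = g (f - s)" for f
    by (rule periodic_site[OF assms])
qed (use base_site in auto)

text \<open>Inequalities between quadratic forms that are sums over cells are thereby reduced to a single
  cell.\<close>

lemma infsum_mono_cells:
  fixes g k :: "'i \<Rightarrow> real"
  assumes g: "g summable_on UNIV" and k: "k summable_on UNIV"
    and le: "\<And>t. t \<in> T \<Longrightarrow> (\<Sum>f\<in>F. g (t + f)) \<le> (\<Sum>f\<in>F. k (t + f))"
  shows "infsum g UNIV \<le> infsum k UNIV"
proof -
  have summ: "(\<lambda>(t, f). h (t + f)) summable_on T \<times> F"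
    and eq: "infsum h UNIV = (\<Sum>\<^sub>\<infinity>t\<in>T. \<Sum>f\<in>F. h (t + f))"
    and summ': "(\<lambda>t. \<Sum>f\<in>F. h (t + f)) summable_on T"
    if h: "h summable_on UNIV" for h :: "'i \<Rightarrow> real"
  proof -
    show s: "(\<lambda>(t, f). h (t + f)) summable_on T \<times> F"
      using summable_on_reindex_bij_betw[OF tiling, of h] h by (simp add: case_prod_unfold)
    have "infsum h UNIV = infsum (\<lambda>(t, f). h (t + f)) (T \<times> F)"
      using infsum_reindex_bij_betw[OF tiling, of h] by (simp add: case_prod_unfold)
    also have "\<dots> = (\<Sum>\<^sub>\<infinity>t\<in>T. \<Sum>f\<in>F. h (t + f))"
      using infsum_Sigma'_banach[OF s] finite_cell by simp
    finally show "infsum h UNIV = (\<Sum>\<^sub>\<infinity>t\<in>T. \<Sum>f\<in>F. h (t + f))" .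
    show "(\<lambda>t. \<Sum>f\<in>F. h (t + f)) summable_on T"
      using summable_on_Sigma_banach[OF s] finite_cell by simp
  qed
  show ?thesis
    unfolding eq[OF g] eq[OF k] by (rule infsum_mono[OF summ'[OF g] summ'[OF k] le])
qed

end

section \<open>Periodic operators of finite range\<close>

text \<open>Only one of the directions \<open>s\<close> and \<open>- s\<close> is listed in \<open>S\<close>; the other is supplied by the adjoint
  part of \<open>edge_op\<close>.\<close>

definition lattice_op :: "('i \<Rightarrow> real) \<Rightarrow> 'i set \<Rightarrow> ('i \<Rightarrow> 'i \<Rightarrow> complex) \<Rightarrow> 'i::ab_group_add ell2 \<Rightarrow> 'i ell2" where
  "lattice_op c S w u = mult_op (\<lambda>i. of_real (c i)) u + (\<Sum>s\<in>S. edge_op (w s) s u)"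

lemma bounded_of_real_range: "bounded (range c) \<Longrightarrow> bounded (range (\<lambda>i. complex_of_real (c i)))"
  by (simp add: bounded_iff)

lemma bounded_linear_lattice_op:
  assumes "bounded (range c)" "\<And>s. s \<in> S \<Longrightarrow> bounded (range (w s))"
  shows "bounded_linear (lattice_op c S w)"
  unfolding lattice_op_def[abs_def]
  by (intro bounded_linear_add bounded_linear_sum bounded_linear_mult_op bounded_linear_edge_op
      bounded_of_real_range assms)

lemma lattice_op_sym:
  assumes "bounded (range c)" "\<And>s. s \<in> S \<Longrightarrow> bounded (range (w s))"
  shows "inner (lattice_op c S w u) v = inner u (lattice_op c S w v)"
  using assms
  by (simp add: lattice_op_def inner_add_left inner_add_right inner_sum_left inner_sum_right
      edge_op_sym inner_mult_op bounded_of_real_range)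

lemma coord_lattice_op:
  assumes "bounded (range c)" "\<And>s. s \<in> S \<Longrightarrow> bounded (range (w s))"
  shows "coord (lattice_op c S w u) i = of_real (c i) * coord u i
    + (\<Sum>s\<in>S. w s i * coord u (i + s) + cnj (w s (i - s)) * coord u (i - s))"
  using assms by (simp add: lattice_op_def coord_edge_op bounded_of_real_range)

context cell_tiling
begin

definition intra_weight :: "('i \<Rightarrow> 'i \<Rightarrow> complex) \<Rightarrow> 'i \<Rightarrow> 'i \<Rightarrow> complex" where
  "intra_weight w s i = (if base (i + s) = base i then w s i else 0)"

definition cut_weight :: "('i \<Rightarrow> 'i \<Rightarrow> complex) \<Rightarrow> 'i \<Rightarrow> 'i \<Rightarrow> complex" where
  "cut_weight w s i = (if base (i + s) = base i then 0 else w s i)"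

text \<open>The diagonal of the operator \<open>D\<close> that controls the cut edges: an edge in direction \<open>s\<close> that ends at \<open>i\<close>
  starts at \<open>i - s\<close>.\<close>

definition cut_degree :: "'i set \<Rightarrow> ('i \<Rightarrow> 'i \<Rightarrow> complex) \<Rightarrow> 'i \<Rightarrow> real" where
  "cut_degree S w i = (\<Sum>s\<in>S. cmod (cut_weight w s i) + cmod (cut_weight w s (i - s)))"

text \<open>The matrix of \<open>lattice_op c S w\<close> restricted to the sites of one cell.\<close>

definition cell_matrix :: "('i \<Rightarrow> real) \<Rightarrow> 'i set \<Rightarrow> ('i \<Rightarrow> 'i \<Rightarrow> complex) \<Rightarrow> 'i \<Rightarrow> 'i \<Rightarrow> complex" where
  "cell_matrix c S w i j = (if i = j then of_real (c i) else 0)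
     + (\<Sum>s\<in>S. (if j = i + s then w s i else 0) + (if i = j + s then cnj (w s j) else 0))"

lemma periodic_intra_weight: "periodic (w s) \<Longrightarrow> periodic (intra_weight w s)"
  and periodic_cut_weight: "periodic (w s) \<Longrightarrow> periodic (cut_weight w s)"
  by (auto simp: periodic_def intra_weight_def cut_weight_def base_site_translate add.assoc)

lemma periodic_shift: "periodic g \<Longrightarrow> periodic (\<lambda>i. g (i - s))"
  unfolding periodic_def by (metis add_diff_eq)

lemma periodic_cut_degree:
  assumes "\<And>s. s \<in> S \<Longrightarrow> periodic (w s)"
  shows "periodic (cut_degree S w)"
  using periodic_cut_weight[of w] periodic_shift[OF periodic_cut_weight[of w]] assms
  unfolding periodic_def cut_degree_def by (intro ballI allI sum.cong refl) metis

text \<open>The difference is the form of the cut edges alone, which \<open>abs_inner_edge_op_le\<close> bounds edge by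
  edge.\<close>

lemma abs_inner_lattice_op_diff_le:
  assumes c: "periodic c" and w: "\<And>s. s \<in> S \<Longrightarrow> periodic (w s)"
  shows "\<bar>inner (lattice_op c S w v) v - inner (lattice_op c S (intra_weight w) v) v\<bar>
    \<le> inner (mult_op (\<lambda>i. of_real (cut_degree S w i)) v) v"
proof -
  have b: "bounded (range (w s))" "bounded (range (intra_weight w s))"
    "bounded (range (cut_weight w s))" if "s \<in> S" for s
    using that w periodic_intra_weight periodic_cut_weight periodic_bounded by blast+
  have bd: "bounded (range (\<lambda>i. complex_of_real (cut_degree S w i)))"
    using periodic_cut_degree[OF w] by (intro bounded_of_real_range periodic_bounded)
  have bs: "bounded (range (\<lambda>i. of_real (cmod (cut_weight w s i) + cmod (cut_weight w s (i - s))) :: complex))"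
    if "s \<in> S" for s
  proof (intro bounded_of_real_range periodic_bounded)
    show "periodic (\<lambda>i. cmod (cut_weight w s i) + cmod (cut_weight w s (i - s)))"
      using periodic_cut_weight[of w s, OF w[OF that]]
        periodic_shift[OF periodic_cut_weight[of w s, OF w[OF that]], of s]
      by (simp add: periodic_def)
  qed
  have "edge_op (w s) s v = edge_op (intra_weight w s) s v + edge_op (cut_weight w s) s v"
    if "s \<in> S" for s
    by (rule ell2_eqI)
      (simp add: coord_edge_op b[OF that], simp add: intra_weight_def cut_weight_def)
  then have "lattice_op c S w v - lattice_op c S (intra_weight w) v = (\<Sum>s\<in>S. edge_op (cut_weight w s) s v)"
    by (simp add: lattice_op_def sum.distrib)
  then have "\<bar>inner (lattice_op c S w v) v - inner (lattice_op c S (intra_weight w) v) v\<bar>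
      = \<bar>\<Sum>s\<in>S. inner (edge_op (cut_weight w s) s v) v\<bar>"
    by (simp only: inner_sum_left flip: inner_diff_left)
  also have "\<dots> \<le> (\<Sum>s\<in>S. inner (mult_op (\<lambda>i. of_real (cmod (cut_weight w s i)
      + cmod (cut_weight w s (i - s)))) v) v)"
    by (intro order_trans[OF sum_abs] sum_mono abs_inner_edge_op_le b)
  also have "\<dots> = inner (mult_op (\<lambda>i. of_real (cut_degree S w i)) v) v"
  proof -
    have "mult_op (\<lambda>i. of_real (cut_degree S w i)) v = (\<Sum>s\<in>S. mult_op (\<lambda>i. of_real (cmod (cut_weight w s i)
      + cmod (cut_weight w s (i - s)))) v)"
    proof (rule ell2_eqI)
      fix i
      have "coord (\<Sum>s\<in>S. mult_op (\<lambda>i. of_real (cmod (cut_weight w s i) + cmod (cut_weight w s (i - s)))) v) i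
        = (\<Sum>s\<in>S. of_real (cmod (cut_weight w s i) + cmod (cut_weight w s (i - s))) * coord v i)"
        unfolding coord_sum by (intro sum.cong refl coord_mult_op bs)
      then show "coord (mult_op (\<lambda>i. of_real (cut_degree S w i)) v) i
        = coord (\<Sum>s\<in>S. mult_op (\<lambda>i. of_real (cmod (cut_weight w s i) + cmod (cut_weight w s (i - s)))) v) i"
        unfolding coord_mult_op[OF bd] by (simp only: cut_degree_def of_real_sum sum_distrib_right)
    qed
    then show ?thesis
      by (simp add: inner_sum_left)
  qed
  finally show ?thesis .
qed

lemma hermitian_cell_matrix: "hermitian_on F (cell_matrix c S w)"
  unfolding hermitian_on_def cell_matrix_def
  by (auto simp: sum.distrib if_distrib[of cnj] add.commute cong: if_cong)

text \<open>Without the cut edges the operator does not couple different cells, and by periodicity it is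
  the same matrix in each of them.\<close>

lemma coord_lattice_op_cell:
  assumes "periodic c" "\<And>s. s \<in> S \<Longrightarrow> periodic (w s)" "t \<in> T" "f \<in> F" "finite S"
  shows "coord (lattice_op c S (intra_weight w) u) (t + f)
    = mat_app F (cell_matrix c S (intra_weight w)) (\<lambda>g. coord u (t + g)) f"
proof -
  let ?w = "intra_weight w"
  have p: "periodic (?w s)" if "s \<in> S" for s
    using that assms(2) periodic_intra_weight by blast
  have out: "(\<Sum>g\<in>F. (if g = f + s then ?w s f else 0) * coord u (t + g)) = ?w s f * coord u (t + f + s)"
    for s
  proof (cases "f + s \<in> F")
    case True
    then show ?thesis
      using finite_cell by (simp add: if_distrib[of "\<lambda>x. x * _"] add.assoc cong: if_cong)
  next
    case False
    then have "?w s f = 0"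
      using mem_cell_iff[of "f + s"] \<open>f \<in> F\<close> by (simp add: intra_weight_def)
    then show ?thesis by (auto intro!: sum.neutral)
  qed
  have inn: "(\<Sum>g\<in>F. (if f = g + s then cnj (?w s g) else 0) * coord u (t + g))
      = cnj (?w s (f - s)) * coord u (t + f - s)" for s
  proof (cases "f - s \<in> F")
    case True
    have "(f = g + s) = (g = f - s)" for g by auto
    then show ?thesis
      using finite_cell True by (simp add: if_distrib[of "\<lambda>x. x * _"] add_diff_eq cong: if_cong)
  next
    case False
    then have "?w s (f - s) = 0"
      using mem_cell_iff[of "f - s"] \<open>f \<in> F\<close> by (simp add: intra_weight_def)
    moreover have "(\<Sum>g\<in>F. (if f = g + s then cnj (?w s g) else 0) * coord u (t + g)) = 0"
      using False by (intro sum.neutral) auto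
    ultimately show ?thesis by simp
  qed
  have "coord (lattice_op c S ?w u) (t + f) = of_real (c f) * coord u (t + f)
      + (\<Sum>s\<in>S. ?w s f * coord u (t + f + s) + cnj (?w s (f - s)) * coord u (t + f - s))"
  proof -
    have "c (t + f) = c f" "\<And>s. s \<in> S \<Longrightarrow> ?w s (t + f) = ?w s f"
      "\<And>s. s \<in> S \<Longrightarrow> ?w s (t + f - s) = ?w s (f - s)"
      using assms(1,3) p by (auto simp: periodic_def add_diff_eq[symmetric])
    then show ?thesis
      using assms(1) p by (simp add: coord_lattice_op periodic_bounded)
  qed
  also have "\<dots> = mat_app F (cell_matrix c S ?w) (\<lambda>g. coord u (t + g)) f"
  proof -
    have "mat_app F (cell_matrix c S ?w) (\<lambda>g. coord u (t + g)) f
      = (\<Sum>g\<in>F. (if f = g then of_real (c f) else 0) * coord u (t + g))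
       + (\<Sum>s\<in>S. (\<Sum>g\<in>F. (if g = f + s then ?w s f else 0) * coord u (t + g))
          + (\<Sum>g\<in>F. (if f = g + s then cnj (?w s g) else 0) * coord u (t + g)))"
      unfolding mat_app_def cell_matrix_def distrib_right sum.distrib sum_distrib_right
      by (simp only: sum.swap[of _ F S])
    also have "(\<Sum>g\<in>F. (if f = g then of_real (c f) else 0) * coord u (t + g)) = of_real (c f) * coord u (t + f)"
      using finite_cell \<open>f \<in> F\<close> by (simp add: if_distrib[of "\<lambda>x. x * _"] cong: if_cong)
    finally show ?thesis
      by (simp add: out inn)
  qed
  finally show ?thesis .
qed

lemma sum_inner_cell_eq_hform:
  assumes "periodic c" "\<And>s. s \<in> S \<Longrightarrow> periodic (w s)" "t \<in> T" "finite S"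
  shows "(\<Sum>f\<in>F. inner (coord (lattice_op c S (intra_weight w) v) (t + f)) (coord v (t + f)))
    = hform F (cell_matrix c S (intra_weight w)) (\<lambda>f. coord v (t + f))"
  unfolding hform_def sprod_def Re_sum
  by (intro sum.cong refl)
    (simp add: coord_lattice_op_cell[OF assms(1,2,3) _ \<open>finite S\<close>] inner_complex_def)

lemma hform_cell_matrix_mono:
  assumes "\<And>i. i \<in> F \<Longrightarrow> c i \<le> c' i"
  shows "hform F (cell_matrix c S w) v \<le> hform F (cell_matrix c' S w) v"
proof -
  have "cell_matrix c' S w i j = cell_matrix c S w i j + (if i = j then of_real (c' i - c i) else 0)" for i j
    by (simp add: cell_matrix_def)
  then have "mat_app F (cell_matrix c' S w) v i = mat_app F (cell_matrix c S w) v i + of_real (c' i - c i) * v i"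
    if "i \<in> F" for i
    using that finite_cell
    by (simp add: mat_app_def distrib_right sum.distrib if_distrib[of "\<lambda>x. x * _"] cong: if_cong del: of_real_diff)
  then have "hform F (cell_matrix c' S w) v
     = hform F (cell_matrix c S w) v + (\<Sum>i\<in>F. (c' i - c i) * (cmod (v i))\<^sup>2)"
  proof -
    assume *: "\<And>i. i \<in> F \<Longrightarrow> mat_app F (cell_matrix c' S w) v i
      = mat_app F (cell_matrix c S w) v i + of_real (c' i - c i) * v i"
    have "Re ((m + of_real r * x) * cnj x) = Re (m * cnj x) + r * (cmod x)\<^sup>2" for m x r
      unfolding cmod_power2 by (simp add: power2_eq_square algebra_simps)
    with * show ?thesis
      unfolding hform_def sprod_def Re_sum sum.distrib[symmetric] by (intro sum.cong refl) simp
  qed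
  moreover have "0 \<le> (\<Sum>i\<in>F. (c' i - c i) * (cmod (v i))\<^sup>2)"
    using assms by (intro sum_nonneg mult_nonneg_nonneg) auto
  ultimately show ?thesis by simp
qed

text \<open>The edges that enter the cell are, up to translation, those that leave it, which accounts for the factor two.\<close>

lemma sum_cut_degree:
  assumes "\<And>s. s \<in> S \<Longrightarrow> periodic (w s)" "finite S"
  shows "(\<Sum>f\<in>F. cut_degree S w f) = 2 * (\<Sum>s\<in>S. \<Sum>f | f \<in> F \<and> f + s \<notin> F. cmod (w s f))"
proof -
  have "(\<Sum>f\<in>F. cut_degree S w f)
      = (\<Sum>s\<in>S. (\<Sum>f\<in>F. cmod (cut_weight w s f)) + (\<Sum>f\<in>F. cmod (cut_weight w s (f - s))))"
    unfolding cut_degree_def by (subst sum.swap) (simp add: sum.distrib)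
  also have "\<dots> = (\<Sum>s\<in>S. 2 * (\<Sum>f\<in>F. cmod (cut_weight w s f)))"
  proof (intro sum.cong refl)
    fix s assume "s \<in> S"
    then have "periodic (\<lambda>f. cmod (cut_weight w s f))"
      using periodic_cut_weight[of w s, OF assms(1)] by (auto simp: periodic_def)
    from sum_periodic_shift[OF this, of s]
    show "(\<Sum>f\<in>F. cmod (cut_weight w s f)) + (\<Sum>f\<in>F. cmod (cut_weight w s (f - s)))
        = 2 * (\<Sum>f\<in>F. cmod (cut_weight w s f))"
      by simp
  qed
  also have "\<dots> = 2 * (\<Sum>s\<in>S. \<Sum>f | f \<in> F \<and> f + s \<notin> F. cmod (w s f))"
  proof -
    have "(\<Sum>f\<in>F. cmod (cut_weight w s f)) = (\<Sum>f | f \<in> F \<and> f + s \<notin> F. cmod (w s f))" for s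
      using finite_cell
      by (intro sum.mono_neutral_cong_right) (auto simp: cut_weight_def mem_cell_iff)
    then show ?thesis
      by (simp add: sum_distrib_left)
  qed
  finally show ?thesis .
qed

text \<open>The sign \<open>\<sigma>\<close> treats the upper bound by \<open>J\<^sub>0 + D\<close> and the lower bound by \<open>J\<^sub>0 - D\<close> together.\<close>

lemma inner_lattice_op_cut_le:
  assumes c: "periodic c" and w: "\<And>s. s \<in> S \<Longrightarrow> periodic (w s)" and "finite S"
    and \<sigma>: "\<bar>\<sigma>\<bar> = 1" and y: "\<And>t. t \<in> T \<Longrightarrow>
      \<sigma> * hform F (cell_matrix (\<lambda>i. c i + \<sigma> * cut_degree S w i) S (intra_weight w)) (\<lambda>f. coord v (t + f))
      \<le> y * sqnorm F (\<lambda>f. coord v (t + f))"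
  shows "\<sigma> * inner (lattice_op c S w v) v \<le> y * (norm v)\<^sup>2"
proof -
  let ?d = "cut_degree S w"
  have d: "periodic (\<lambda>i. c i + \<sigma> * ?d i)"
    using c periodic_cut_degree[OF w] by (simp add: periodic_def)
  have bw: "bounded (range (intra_weight w s))" if "s \<in> S" for s
    using that w periodic_intra_weight periodic_bounded by blast
  note bc = periodic_bounded[OF c] periodic_bounded[OF periodic_cut_degree[of S w, OF w]] periodic_bounded[OF d]
  let ?J = "lattice_op (\<lambda>i. c i + \<sigma> * ?d i) S (intra_weight w)"
  have "?J v = lattice_op c S (intra_weight w) v + \<sigma> *\<^sub>R mult_op (\<lambda>i. of_real (?d i)) v"
    by (rule ell2_eqI)
      (simp add: coord_lattice_op[OF bc(3) bw] coord_lattice_op[OF bc(1) bw] bounded_of_real_range[OF bc(2)]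
        scaleR_conv_of_real algebra_simps)
  then have J: "inner (?J v) v = inner (lattice_op c S (intra_weight w) v) v
      + \<sigma> * inner (mult_op (\<lambda>i. of_real (?d i)) v) v"
    by (simp add: inner_add_left)
  have "\<sigma> * inner (lattice_op c S w v) v \<le> \<sigma> * inner (?J v) v"
    using abs_inner_lattice_op_diff_le[of c S w v, OF c w] \<sigma> unfolding J
    by (cases "\<sigma> = 1") (auto simp: abs_if split: if_splits)
  also have "\<dots> = (\<Sum>\<^sub>\<infinity>i. \<sigma> * inner (coord (?J v) i) (coord v i))"
    by (simp add: inner_ell2_def infsum_cmult_right')
  also have "\<dots> \<le> (\<Sum>\<^sub>\<infinity>i. y * (cmod (coord v i))\<^sup>2)"
  proof (rule infsum_mono_cells)
    show "(\<lambda>i. \<sigma> * inner (coord (?J v) i) (coord v i)) summable_on UNIV"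
      by (intro summable_on_cmult_right summable_inner_coord)
    show "(\<lambda>i. y * (cmod (coord v i))\<^sup>2) summable_on UNIV"
      by (intro summable_on_cmult_right coord_summable)
    fix t assume "t \<in> T"
    show "(\<Sum>f\<in>F. \<sigma> * inner (coord (?J v) (t + f)) (coord v (t + f)))
        \<le> (\<Sum>f\<in>F. y * (cmod (coord v (t + f)))\<^sup>2)"
      using y[OF \<open>t \<in> T\<close>]
      by (simp add: sum_inner_cell_eq_hform[OF d w \<open>t \<in> T\<close> \<open>finite S\<close>] sqnorm_def flip: sum_distrib_left)
  qed
  also have "\<dots> = y * (norm v)\<^sup>2"
    by (simp add: norm_ell2_square infsum_cmult_right')
  finally show ?thesis .
qed

text \<open>The matrix \<open>P\<close> acting in every cell, written with shifts and multiplications so that it visibly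
  maps the Hilbert space to itself.\<close>

definition cellwise_op :: "('i \<Rightarrow> 'i \<Rightarrow> complex) \<Rightarrow> 'i ell2 \<Rightarrow> 'i ell2" where
  "cellwise_op P u = (\<Sum>f\<in>F. \<Sum>g\<in>F. mult_op (\<lambda>i. if site i = f then P f g else 0) (shift (g - f) u))"

lemma coord_cellwise_op:
  assumes "t \<in> T" "f \<in> F"
  shows "coord (cellwise_op P u) (t + f) = mat_app F P (\<lambda>g. coord u (t + g)) f"
proof -
  have b: "bounded (range (\<lambda>i. if site i = f then P f g else 0))" for f g
    by (rule periodic_bounded) (simp add: periodic_def base_site_translate)
  have "coord (cellwise_op P u) (t + f)
      = (\<Sum>f'\<in>F. \<Sum>g\<in>F. (if f = f' then P f' g else 0) * coord u (t + f + (g - f')))"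
    using assms by (simp add: cellwise_op_def coord_mult_op[OF b] base_site_translate)
  also have "\<dots> = (\<Sum>f'\<in>F. if f = f' then \<Sum>g\<in>F. P f' g * coord u (t + f + (g - f')) else 0)"
    by (intro sum.cong refl) auto
  also have "\<dots> = mat_app F P (\<lambda>g. coord u (t + g)) f"
    using assms finite_cell by (simp add: mat_app_def algebra_simps)
  finally show ?thesis .
qed

text \<open>The estimate of the spectrum for a periodic operator of finite range on any group with a
  finite cell: four times the weight of the edges that leave one cell.\<close>

theorem lattice_op_invertible_off_small_set:
  assumes c: "periodic c" and w: "\<And>s. s \<in> S \<Longrightarrow> periodic (w s)" and "finite S"
  obtains E where "E \<in> sets borel"
    "emeasure lborel E \<le> ennreal (4 * (\<Sum>s\<in>S. \<Sum>f | f \<in> F \<and> f + s \<notin> F. cmod (w s f)))"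
    "\<And>x. x \<notin> E \<Longrightarrow> bij (\<lambda>u. lattice_op c S w u - x *\<^sub>R u)
        \<and> (\<exists>k>0. \<forall>u. k * norm u \<le> norm (lattice_op c S w u - x *\<^sub>R u))"
proof -
  let ?d = "cut_degree S w" and ?J = "lattice_op c S w"
  define hp where "hp = cell_matrix (\<lambda>i. c i + 1 * ?d i) S (intra_weight w)"
  define hm where "hm = cell_matrix (\<lambda>i. c i + (- 1) * ?d i) S (intra_weight w)"
  have d_nonneg: "0 \<le> ?d i" for i
    by (simp add: cut_degree_def sum_nonneg)
  have le: "hform F hm v \<le> hform F hp v" for v
    unfolding hm_def hp_def by (rule hform_cell_matrix_mono) (use d_nonneg in simp)
  have herm: "hermitian_on F hm" "hermitian_on F hp"
    unfolding hm_def hp_def by (rule hermitian_cell_matrix)+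
  show thesis
  proof (rule form_splitting_off_small_set[OF finite_cell herm le])
    fix E :: "real set"
    assume E: "E \<in> sets borel"
      "emeasure lborel E \<le> ennreal (\<Sum>i\<in>F. Re (hp i i) - Re (hm i i))"
      "\<And>x. x \<notin> E \<Longrightarrow> \<exists>\<delta>>0. \<exists>P. \<forall>u v w. (\<forall>i\<in>F. v i = mat_app F P u i) \<longrightarrow> (\<forall>i\<in>F. w i = u i - v i) \<longrightarrow>
        hform F hp v \<le> (x - \<delta>) * sqnorm F v \<and> (x + \<delta>) * sqnorm F w \<le> hform F hm w"
    show thesis
    proof (rule that[OF E(1)])
      have "(\<Sum>i\<in>F. Re (hp i i) - Re (hm i i)) = (\<Sum>i\<in>F. 2 * ?d i)"
        by (simp add: hp_def hm_def cell_matrix_def)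
      also have "\<dots> = 4 * (\<Sum>s\<in>S. \<Sum>f | f \<in> F \<and> f + s \<notin> F. cmod (w s f))"
        using sum_cut_degree[OF w \<open>finite S\<close>] by (simp flip: sum_distrib_left)
      finally show "emeasure lborel E \<le> ennreal (4 * (\<Sum>s\<in>S. \<Sum>f | f \<in> F \<and> f + s \<notin> F. cmod (w s f)))"
        using E(2) by simp
      fix x assume "x \<notin> E"
      then obtain \<delta> P where "\<delta> > 0" and P: "\<And>u v w. (\<And>i. i \<in> F \<Longrightarrow> v i = mat_app F P u i) \<Longrightarrow>
          (\<And>i. i \<in> F \<Longrightarrow> w i = u i - v i) \<Longrightarrow>
          hform F hp v \<le> (x - \<delta>) * sqnorm F v \<and> (x + \<delta>) * sqnorm F w \<le> hform F hm w"
        using E(3) by metis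
      let ?A = "\<lambda>u. ?J u - x *\<^sub>R u"
      have bnd: "bounded (range c)" "\<And>s. s \<in> S \<Longrightarrow> bounded (range (w s))"
        using c w periodic_bounded by blast+
      have A: "bounded_linear ?A"
        by (intro bounded_linear_sub bounded_linear_lattice_op bnd bounded_linear_scaleR_right)
      have sym: "inner (?A u) v = inner u (?A v)" for u v
        by (simp add: inner_diff_left inner_diff_right lattice_op_sym[OF bnd])
      have below: "\<delta> / 2 * norm u \<le> norm (?A u)" for u
      proof (rule indefinite_splitting_bounded_below[OF linear_add[OF bounded_linear.linear[OF A]] sym])
        let ?v = "cellwise_op P u" and ?w = "u - cellwise_op P u"
        show "u = ?v + ?w" by simp
        have cell: "hform F hp (\<lambda>f. coord ?v (t + f)) \<le> (x - \<delta>) * sqnorm F (\<lambda>f. coord ?v (t + f))"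
          "(x + \<delta>) * sqnorm F (\<lambda>f. coord ?w (t + f)) \<le> hform F hm (\<lambda>f. coord ?w (t + f))" if "t \<in> T" for t
          using P[of "\<lambda>f. coord ?v (t + f)" "\<lambda>f. coord u (t + f)" "\<lambda>f. coord ?w (t + f)"]
            coord_cellwise_op[OF that] by simp_all
        have "1 * inner (?J ?v) ?v \<le> (x - \<delta>) * (norm ?v)\<^sup>2"
          by (rule inner_lattice_op_cut_le[OF c w \<open>finite S\<close>]) (use cell(1) in \<open>simp_all add: hp_def\<close>)
        then show "inner (?A ?v) ?v \<le> - \<delta> * (norm ?v)\<^sup>2"
          by (simp add: inner_diff_left power2_norm_eq_inner algebra_simps)
        have "(- 1) * inner (?J ?w) ?w \<le> (- (x + \<delta>)) * (norm ?w)\<^sup>2"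
          by (rule inner_lattice_op_cut_le[OF c w \<open>finite S\<close>]) (use cell(2) in \<open>simp_all add: hm_def algebra_simps\<close>)
        then have "(x + \<delta>) * (norm ?w)\<^sup>2 \<le> inner (?J ?w) ?w"
          by (simp only: mult_minus_left mult_1_left neg_le_iff_le)
        moreover have "inner (?A ?w) ?w = inner (?J ?w) ?w - x * (norm ?w)\<^sup>2"
          by (simp only: inner_diff_left[of "?J ?w"] power2_norm_eq_inner inner_scaleR_left)
        ultimately show "\<delta> * (norm ?w)\<^sup>2 \<le> inner (?A ?w) ?w"
          by (simp only: distrib_right)
      qed (rule \<open>\<delta> > 0\<close>)
      have "bij ?A"
        by (rule bounded_below_symmetric_imp_bij[OF A sym below]) (use \<open>\<delta> > 0\<close> in simp)
      then show "bij ?A \<and> (\<exists>k>0. \<forall>u. k * norm u \<le> norm (?A u))"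
        using below \<open>\<delta> > 0\<close> half_gt_zero by blast
    qed
  qed
qed

end

section \<open>Double sequences and the spectrum\<close>

text \<open>The terms are nonnegative, so iterated and joint summability coincide.\<close>

lemma l2l2_iff: "u \<in> l2l2 \<longleftrightarrow> (\<lambda>i. (cmod (case_prod u i))\<^sup>2) summable_on UNIV"
proof -
  let ?g = "\<lambda>i. (cmod (case_prod u i))\<^sup>2"
  have sq: "(l2_norm (u q))\<^sup>2 = (\<Sum>\<^sub>\<infinity>r. (cmod (u q r))\<^sup>2)" for q
    by (simp add: l2_norm_def infsum_nonneg)
  show ?thesis
  proof
    assume u: "u \<in> l2l2"
    have "?g summable_on (Sigma UNIV (\<lambda>_. UNIV))"
    proof (rule summable_on_SigmaI)
      show "((\<lambda>r. ?g (q, r)) has_sum (l2_norm (u q))\<^sup>2) UNIV" for q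
        using u unfolding sq by (auto simp: l2l2_def l2_def)
      show "(\<lambda>q. (l2_norm (u q))\<^sup>2) summable_on UNIV"
        using u by (simp add: l2l2_def)
    qed simp
    then show "?g summable_on UNIV"
      by simp
  next
    assume g: "?g summable_on UNIV"
    then have s: "(\<lambda>(q, r). (cmod (u q r))\<^sup>2) summable_on (Sigma UNIV (\<lambda>_. UNIV))"
      by (simp add: case_prod_unfold)
    have "(\<lambda>q. (l2_norm (u q))\<^sup>2) summable_on UNIV"
      unfolding sq by (rule summable_on_Sigma_banach[OF s])
    moreover have "u q \<in> l2" for q
      using summable_on_SigmaD1[OF s, of q] by (simp add: l2_def)
    ultimately show "u \<in> l2l2"
      by (simp add: l2l2_def)
  qed
qed

definition to_ell2 :: "(int \<Rightarrow> int \<Rightarrow> complex) \<Rightarrow> (int \<times> int) ell2" where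
  "to_ell2 u = Ell2 (case_prod u)"

definition of_ell2 :: "(int \<times> int) ell2 \<Rightarrow> int \<Rightarrow> int \<Rightarrow> complex" where
  "of_ell2 v q r = coord v (q, r)"

lemma coord_to_ell2: "u \<in> l2l2 \<Longrightarrow> coord (to_ell2 u) (q, r) = u q r"
  by (simp add: to_ell2_def Ell2_inverse l2l2_iff)

lemma of_to_ell2: "u \<in> l2l2 \<Longrightarrow> of_ell2 (to_ell2 u) = u"
  by (intro ext) (simp add: of_ell2_def coord_to_ell2)

lemma of_ell2_in_l2l2: "of_ell2 v \<in> l2l2"
  using coord_summable[of v] by (simp add: l2l2_iff of_ell2_def[abs_def])

lemma to_of_ell2: "to_ell2 (of_ell2 v) = v"
  by (rule ell2_eqI) (auto simp: coord_to_ell2[OF of_ell2_in_l2l2] of_ell2_def)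

lemma l2l2_norm_of_ell2: "l2l2_norm (of_ell2 v) = norm v"
proof -
  have sq: "(l2_norm (of_ell2 v q))\<^sup>2 = (\<Sum>\<^sub>\<infinity>r. (cmod (coord v (q, r)))\<^sup>2)" for q
    by (simp add: l2_norm_def infsum_nonneg of_ell2_def)
  have "(\<Sum>\<^sub>\<infinity>q. (l2_norm (of_ell2 v q))\<^sup>2) = (norm v)\<^sup>2"
    unfolding sq norm_ell2_square
    using infsum_Sigma_banach[of "\<lambda>i. (cmod (coord v i))\<^sup>2" UNIV "\<lambda>_. UNIV"] coord_summable[of v]
    by simp
  then show ?thesis
    by (simp add: l2l2_norm_def)
qed

lemma l2l2_norm_to_ell2: "u \<in> l2l2 \<Longrightarrow> norm (to_ell2 u) = l2l2_norm u"
  using l2l2_norm_of_ell2[of "to_ell2 u"] of_to_ell2 by simp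

text \<open>The type \<open>ell2\<close> has real scalars only, so the complex homogeneity that \<open>bounded_op\<close> demands of the
  inverse is derived from that of \<open>A\<close>.\<close>

lemma not_in_spectrum:
  fixes A :: "(int \<times> int) ell2 \<Rightarrow> (int \<times> int) ell2"
  assumes TA: "\<And>u. u \<in> l2l2 \<Longrightarrow> T u = of_ell2 (A (to_ell2 u))"
    and add: "\<And>u v. A (u + v) = A u + A v"
    and scale: "\<And>z u. A (mult_op (\<lambda>_. z) u) = mult_op (\<lambda>_. z) (A u)"
    and bij: "bij (\<lambda>u. A u - x *\<^sub>R u)"
    and "k > 0" and below: "\<And>u. k * norm u \<le> norm (A u - x *\<^sub>R u)"
  shows "complex_of_real x \<notin> spectrum T"
proof -
  define B where "B = inv (\<lambda>u. A u - x *\<^sub>R u)"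
  have AB: "A (B v) - x *\<^sub>R B v = v" for v
    using surj_f_inv_f[OF bij_is_surj[OF bij], of v] by (simp add: B_def)
  have BA: "B (A u - x *\<^sub>R u) = u" for u
    using inv_f_f[OF bij_is_inj[OF bij], of u] by (simp add: B_def)
  have Badd: "B (u + v) = B u + B v" for u v
    using BA[of "B u + B v"] AB[of u] AB[of v] by (simp add: add algebra_simps)
  have mult_coord: "coord (mult_op (\<lambda>_. z) v) i = z * coord v i" for z v and i :: "int \<times> int"
    by simp
  have Bscale: "B (mult_op (\<lambda>_. z) v) = mult_op (\<lambda>_. z) (B v)" for z v
  proof -
    have "A (mult_op (\<lambda>_. z) (B v)) - x *\<^sub>R mult_op (\<lambda>_. z) (B v)
        = mult_op (\<lambda>_. z) (A (B v) - x *\<^sub>R B v)"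
      by (rule ell2_eqI) (simp add: scale mult_coord scaleR_conv_of_real algebra_simps)
    then show ?thesis
      using BA[of "mult_op (\<lambda>_. z) (B v)"] by (simp add: AB)
  qed
  define S where "S u = of_ell2 (B (to_ell2 u))" for u
  have S_in: "S u \<in> l2l2" for u
    by (simp add: S_def of_ell2_in_l2l2)
  have of_eq: "of_ell2 v = u" if "\<And>q r. coord v (q, r) = u q r" for u v
    by (intro ext) (simp add: of_ell2_def that)
  have to_eq: "to_ell2 u = v" if "\<And>q r. coord v (q, r) = u q r" for u v
    using of_eq[OF that] to_of_ell2 by metis
  have "bounded_op S"
    unfolding bounded_op_def
  proof (intro conjI ballI allI S_in)
    fix u v assume uv: "u \<in> l2l2" "v \<in> l2l2"
    have "to_ell2 (\<lambda>q r. u q r + v q r) = to_ell2 u + to_ell2 v"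
      by (rule to_eq) (simp add: coord_to_ell2 uv)
    then show "S (\<lambda>q r. u q r + v q r) = (\<lambda>q r. S u q r + S v q r)"
      by (simp add: S_def Badd of_ell2_def fun_eq_iff)
  next
    fix z u assume u: "u \<in> l2l2"
    have "to_ell2 (\<lambda>q r. z * u q r) = mult_op (\<lambda>_. z) (to_ell2 u)"
      by (rule to_eq) (simp add: coord_to_ell2 u)
    then show "S (\<lambda>q r. z * u q r) = (\<lambda>q r. z * S u q r)"
      by (simp add: S_def Bscale of_ell2_def fun_eq_iff)
  next
    have "l2l2_norm (S u) \<le> 1 / k * l2l2_norm u" if "u \<in> l2l2" for u
      using below[of "B (to_ell2 u)"] \<open>k > 0\<close>
      by (simp add: AB S_def l2l2_norm_of_ell2 l2l2_norm_to_ell2[OF that] field_simps)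
    then show "\<exists>C. \<forall>u\<in>l2l2. l2l2_norm (S u) \<le> C * l2l2_norm u"
      by blast
  qed
  moreover have "S (\<lambda>q r. T u q r - complex_of_real x * u q r) = u" if u: "u \<in> l2l2" for u
  proof -
    have "to_ell2 (\<lambda>q r. T u q r - complex_of_real x * u q r) = A (to_ell2 u) - x *\<^sub>R to_ell2 u"
      by (rule to_eq) (simp add: coord_to_ell2 u TA of_ell2_def scaleR_conv_of_real)
    then show ?thesis
      by (simp add: S_def BA of_to_ell2 u)
  qed
  moreover have "(\<lambda>q r. T (S u) q r - complex_of_real x * S u q r) = u" if u: "u \<in> l2l2" for u
  proof -
    have "(\<lambda>q r. T (S u) q r - complex_of_real x * S u q r)
       = of_ell2 (A (B (to_ell2 u)) - x *\<^sub>R B (to_ell2 u))"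
      by (simp add: TA[OF S_in]) (simp add: S_def to_of_ell2 of_ell2_def fun_eq_iff scaleR_conv_of_real)
    then show ?thesis
      by (simp add: AB of_to_ell2 u)
  qed
  ultimately show ?thesis
    unfolding spectrum_def by blast
qed

section \<open>Jacobi-block-Jacobi operators\<close>

definition jbj_offsets :: "(int \<times> int) set" where
  "jbj_offsets = {(0, 1), (1, 0), (1, 1), (1, -1)}"

text \<open>The weight on the antidiagonal is conjugated and shifted: the entry of \<open>A\<^sub>q\<close> that takes
  \<open>(q + 1, r - 1)\<close> to \<open>(q, r)\<close> lies below the diagonal.\<close>

definition jbj_weight :: "(int \<Rightarrow> int \<Rightarrow> real) \<Rightarrow> (int \<Rightarrow> int \<Rightarrow> complex) \<Rightarrow> (int \<Rightarrow> int \<Rightarrow> complex)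
    \<Rightarrow> int \<times> int \<Rightarrow> int \<times> int \<Rightarrow> complex" where
  "jbj_weight a \<alpha> b s = (\<lambda>(q, r). if s = (0, 1) then b q r else if s = (1, 0) then of_real (a q r)
     else if s = (1, 1) then \<alpha> q r else cnj (\<alpha> q (r - 1)))"

lemma jbj_eq_lattice_op:
  assumes "u \<in> l2l2" "bounded (range (\<lambda>(q, r). c q r))"
    "\<And>s. s \<in> jbj_offsets \<Longrightarrow> bounded (range (jbj_weight a \<alpha> b s))"
  shows "jbj a \<alpha> c b u = of_ell2 (lattice_op (\<lambda>(q, r). c q r) jbj_offsets (jbj_weight a \<alpha> b) (to_ell2 u))"
proof (intro ext)
  fix q r
  show "jbj a \<alpha> c b u q r
      = of_ell2 (lattice_op (\<lambda>(q, r). c q r) jbj_offsets (jbj_weight a \<alpha> b) (to_ell2 u)) q r"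
    by (simp add: of_ell2_def coord_lattice_op[OF assms(2,3)])
      (simp add: jbj_offsets_def jbj_weight_def coord_to_ell2[OF assms(1)] jbj_def jacobi_def
        algebra_simps)
qed

text \<open>Division with remainder in each coordinate.\<close>

lemma cell_tiling_rectangle:
  fixes p1 p2 m n :: int
  assumes "p1 > 0" "p2 > 0"
  shows "cell_tiling (range (\<lambda>(k1, k2). (k1 * p1, k2 * p2))) ({m+1..m+p1} \<times> {n+1..n+p2})"
proof
  let ?T = "range (\<lambda>(k1, k2). (k1 * p1, k2 * p2))" and ?F = "{m+1..m+p1} \<times> {n+1..n+p2}"
  show "finite ?F" by simp
  show "0 \<in> ?T" by (rule image_eqI[of _ _ "(0, 0)"]) (auto simp: zero_prod_def)
  show "s - t \<in> ?T" if st: "s \<in> ?T" "t \<in> ?T" for s t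
  proof -
    obtain k l k' l' where "s = (k * p1, l * p2)" "t = (k' * p1, l' * p2)"
      using st by auto
    then show ?thesis
      by (intro image_eqI[of _ _ "(k - k', l - l')"]) (auto simp: algebra_simps)
  qed
  have one: "k = k' \<and> f = f'" if "k * p + f = k' * p + f'" "f \<in> {x+1..x+p}" "f' \<in> {x+1..x+p}" "p > 0"
    for k k' f f' p x :: int
  proof -
    have "(f - x - 1) mod p = f - x - 1" "(f' - x - 1) mod p = f' - x - 1"
      using that by auto
    moreover have "f - x - 1 = (f' - x - 1) + (k' - k) * p"
      using that(1) by (simp add: algebra_simps)
    ultimately have "f = f'"
      using mod_mult_self1[of "f' - x - 1" "k' - k" p] by simp
    then show ?thesis using that by simp
  qed
  have ex: "\<exists>k. \<exists>f\<in>{x+1..x+p}. i = k * p + f" if "p > 0" for i x p :: int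
  proof (intro exI bexI)
    show "i = (i - x - 1) div p * p + ((i - x - 1) mod p + x + 1)"
      using div_mult_mod_eq[of "i - x - 1" p] by linarith
    show "(i - x - 1) mod p + x + 1 \<in> {x+1..x+p}"
      using pos_mod_bound[OF that, of "i - x - 1"] pos_mod_sign[OF that, of "i - x - 1"]
      unfolding atLeastAtMost_iff by linarith
  qed
  show "bij_betw (\<lambda>(t, f). t + f) (?T \<times> ?F) UNIV"
    unfolding bij_betw_def
  proof
    show "inj_on (\<lambda>(t, f). t + f) (?T \<times> ?F)"
    proof (rule inj_onI)
      fix x y assume x: "x \<in> ?T \<times> ?F" and y: "y \<in> ?T \<times> ?F"
        and eq: "(\<lambda>(t, f). t + f) x = (\<lambda>(t, f). t + f) y"
      obtain k l f g where x': "x = ((k * p1, l * p2), (f, g))"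
        "f \<in> {m+1..m+p1}" "g \<in> {n+1..n+p2}"
        using x by (auto simp del: atLeastAtMost_iff)
      obtain k' l' f' g' where y': "y = ((k' * p1, l' * p2), (f', g'))"
        "f' \<in> {m+1..m+p1}" "g' \<in> {n+1..n+p2}"
        using y by (auto simp del: atLeastAtMost_iff)
      have e: "k * p1 + f = k' * p1 + f'" "l * p2 + g = l' * p2 + g'"
        using eq x'(1) y'(1) by simp_all
      then show "x = y"
        using one[OF e(1) x'(2) y'(2) assms(1)] one[OF e(2) x'(3) y'(3) assms(2)] x'(1) y'(1) by simp
    qed
    show "(\<lambda>(t, f). t + f) ` (?T \<times> ?F) = UNIV"
    proof (intro set_eqI iffI UNIV_I)
      fix i :: "int \<times> int"
      obtain k f l g where "f \<in> {m+1..m+p1}" "g \<in> {n+1..n+p2}" "fst i = k * p1 + f" "snd i = l * p2 + g"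
        using ex[OF assms(1), of m "fst i"] ex[OF assms(2), of n "snd i"] by blast
      then show "i \<in> (\<lambda>(t, f). t + f) ` (?T \<times> ?F)"
        by (intro image_eqI[of _ _ "((k * p1, l * p2), (f, g))"]) (auto simp: prod_eq_iff)
    qed
  qed
qed

lemma sum_periodic_window:
  fixes g :: "int \<Rightarrow> real"
  assumes "p > 0" and g: "\<And>i k. g (i + k * p) = g i"
  shows "(\<Sum>i=x+1..x+p. g i) = (\<Sum>i=1..p. g i)"
proof (rule sum.reindex_bij_witness[of _ "\<lambda>i. (i - x - 1) mod p + x + 1" "\<lambda>i. (i - 1) mod p + 1"])
  have m: "(((i - y - 1) mod p + y + 1) - z - 1) mod p + z + 1 = i" if "i \<in> {z+1..z+p}" for i y z
  proof -
    have "(((i - y - 1) mod p + y + 1) - z - 1) mod p = ((i - y - 1) mod p + (y - z)) mod p"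
      by (simp add: algebra_simps)
    also have "\<dots> = ((i - y - 1) + (y - z)) mod p"
      by (rule mod_add_left_eq)
    also have "\<dots> = i - z - 1"
      using that by (simp add: algebra_simps)
    finally show ?thesis by simp
  qed
  show "((i - 1) mod p + 1 - x - 1) mod p + x + 1 = i" if "i \<in> {x+1..x+p}" for i
    using m[OF that, of 0] by simp
  show "((i - x - 1) mod p + x + 1 - 1) mod p + 1 = i" if "i \<in> {1..p}" for i
    using m[of i 0 x] that by simp
  show "(i - 1) mod p + 1 \<in> {1..p}" "(i - x - 1) mod p + x + 1 \<in> {x+1..x+p}" for i
    using pos_mod_bound[OF \<open>p > 0\<close>, of "i - 1"] pos_mod_sign[OF \<open>p > 0\<close>, of "i - 1"]
      pos_mod_bound[OF \<open>p > 0\<close>, of "i - x - 1"] pos_mod_sign[OF \<open>p > 0\<close>, of "i - x - 1"]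
    unfolding atLeastAtMost_iff by linarith+
  show "g ((i - 1) mod p + 1) = g i" for i
    using g[of "(i - 1) mod p + 1" "(i - 1) div p"] by (simp add: algebra_simps)
qed

lemma sum_times: "(\<Sum>i\<in>A \<times> B. h (fst i) (snd i)) = (\<Sum>q\<in>A. \<Sum>r\<in>B. h q r)"
  by (simp add: sum.cartesian_product case_prod_unfold)

lemma sum_cross:
  fixes h :: "'a \<Rightarrow> 'b \<Rightarrow> real"
  assumes "finite I" "finite K" "q0 \<in> I" "r0 \<in> K"
  shows "(\<Sum>i | i \<in> I \<times> K \<and> (fst i = q0 \<or> snd i = r0). h (fst i) (snd i))
    = (\<Sum>r\<in>K. h q0 r) + (\<Sum>q\<in>I. h q r0) - h q0 r0"
proof -
  have "{i. i \<in> I \<times> K \<and> (fst i = q0 \<or> snd i = r0)} = {q0} \<times> K \<union> (I - {q0}) \<times> {r0}"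
    using assms by auto
  moreover have "(\<Sum>i\<in>{q0} \<times> K \<union> (I - {q0}) \<times> {r0}. h (fst i) (snd i))
      = (\<Sum>i\<in>{q0} \<times> K. h (fst i) (snd i)) + (\<Sum>i\<in>(I - {q0}) \<times> {r0}. h (fst i) (snd i))"
    using assms by (intro sum.union_disjoint) auto
  moreover have "\<dots> = (\<Sum>r\<in>K. h q0 r) + (\<Sum>q\<in>I - {q0}. h q r0)"
    by (simp add: sum_times[of h])
  moreover have "(\<Sum>q\<in>I. h q r0) = h q0 r0 + (\<Sum>q\<in>I - {q0}. h q r0)"
    using assms by (simp add: sum.remove)
  ultimately show ?thesis
    by simp
qed

lemma periodic2_add_period:
  assumes "periodic2 p1 p2 w"
  shows "w (q + p1) r = w q r" "w q (r + p2) = w q r"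
proof -
  have *: "w (q + k1 * p1) (r + k2 * p2) = w q r" for q r k1 k2
    using assms by (simp add: periodic2_def)
  show "w (q + p1) r = w q r" "w q (r + p2) = w q r"
    using *[of q 1 r 0] *[of q 0 r 1] by simp_all
qed

lemma periodic2_compose:
  assumes "periodic2 p1 p2 w"
  shows "periodic2 p1 p2 (\<lambda>q r. \<phi> (w q (r - d)))"
  unfolding periodic2_def
proof (intro allI)
  fix q r k1 k2
  have "w (q + k1 * p1) (r - d + k2 * p2) = w q (r - d)"
    using assms unfolding periodic2_def by blast
  moreover have "r + k2 * p2 - d = r - d + k2 * p2"
    by simp
  ultimately show "\<phi> (w (q + k1 * p1) (r + k2 * p2 - d)) = \<phi> (w q (r - d))"
    by (simp only:)
qed

text \<open>Edges in direction \<open>(0, 1)\<close> leave the rectangle from the sites with \<open>r = n + p2\<close>, those in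
  direction \<open>(1, 0)\<close> from \<open>q = m + p1\<close>. Edges in the diagonal directions \<open>(1, 1)\<close> and \<open>(1, -1)\<close> leave it from
  \<open>q = m + p1\<close> and also from \<open>r = n + p2\<close> or \<open>r = n + 1\<close>, respectively. The corner site of such a
  union of a row and a column is counted once; for the two diagonal directions together this
  produces the term \<open>- 8 * cmod (\<alpha> m n)\<close>.\<close>

lemma crossing_weight_eq_jbj_R:
  assumes "p1 > 0" "p2 > 0"
    and a: "periodic2 p1 p2 a" and \<alpha>: "periodic2 p1 p2 \<alpha>" and b: "periodic2 p1 p2 b"
  shows "4 * (\<Sum>s\<in>jbj_offsets. \<Sum>i | i \<in> {m+1..m+p1} \<times> {n+1..n+p2} \<and>
        i + s \<notin> {m+1..m+p1} \<times> {n+1..n+p2}. cmod (jbj_weight a \<alpha> b s i))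
    = jbj_R p1 p2 a \<alpha> b m n"
proof -
  let ?I = "{m+1..m+p1}" and ?K = "{n+1..n+p2}"
  define X where "X s = (\<Sum>i | i \<in> ?I \<times> ?K \<and> i + s \<notin> ?I \<times> ?K. cmod (jbj_weight a \<alpha> b s i))" for s
  have win1: "(\<Sum>q\<in>?I. h q r) = (\<Sum>q=1..p1. h q r)" if "periodic2 p1 p2 h" for h :: "int \<Rightarrow> int \<Rightarrow> real" and r
    using that \<open>p1 > 0\<close> unfolding periodic2_def
    by (intro sum_periodic_window) (metis add.right_neutral mult_zero_left)+
  have win2: "(\<Sum>r\<in>?K. h q r) = (\<Sum>r=1..p2. h q r)" if "periodic2 p1 p2 h" for h :: "int \<Rightarrow> int \<Rightarrow> real" and q
    using that \<open>p2 > 0\<close> unfolding periodic2_def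
    by (intro sum_periodic_window) (metis add.right_neutral mult_zero_left)+
  note per = periodic2_add_period
  have pa: "periodic2 p1 p2 (\<lambda>q r. \<bar>a q r\<bar>)" and pb: "periodic2 p1 p2 (\<lambda>q r. cmod (b q r))"
    and p\<alpha>: "periodic2 p1 p2 (\<lambda>q r. cmod (\<alpha> q r))" and p\<alpha>': "periodic2 p1 p2 (\<lambda>q r. cmod (\<alpha> q (r - 1)))"
    using periodic2_compose[OF a, of abs 0] periodic2_compose[OF b, of cmod 0]
      periodic2_compose[OF \<alpha>, of cmod 0] periodic2_compose[OF \<alpha>, of cmod 1] by simp_all
  have X01: "X (0, 1) = (\<Sum>q=1..p1. cmod (b q n))"
  proof -
    have "{i. i \<in> ?I \<times> ?K \<and> i + (0, 1) \<notin> ?I \<times> ?K} = ?I \<times> {n + p2}"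
      using assms by auto
    then show ?thesis
      by (simp add: X_def jbj_weight_def case_prod_unfold per[OF b]
          sum_times[of "\<lambda>q r. cmod (b q r)"] flip: win1[OF pb])
  qed
  have X10: "X (1, 0) = (\<Sum>r=1..p2. \<bar>a m r\<bar>)"
  proof -
    have "{i. i \<in> ?I \<times> ?K \<and> i + (1, 0) \<notin> ?I \<times> ?K} = {m + p1} \<times> ?K"
      using assms by auto
    then show ?thesis
      by (simp add: X_def jbj_weight_def case_prod_unfold per[OF a]
          sum_times[of "\<lambda>q r. \<bar>a q r\<bar>"] flip: win2[OF pa])
  qed
  have cross: "(\<Sum>i | i \<in> ?I \<times> ?K \<and> (fst i = m + p1 \<or> snd i = r0). h (fst i) (snd i))
      = (\<Sum>r=1..p2. h m r) + (\<Sum>q=1..p1. h q r0) - h m r0"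
    if h: "periodic2 p1 p2 h" and "r0 \<in> ?K" for h :: "int \<Rightarrow> int \<Rightarrow> real" and r0
  proof -
    have "m + p1 \<in> ?I"
      using assms(1) by simp
    from sum_cross[OF _ _ this that(2), of h] show ?thesis
      by (simp only: per[OF h] win1[OF h] win2[OF h] finite_atLeastAtMost_int)
  qed
  have X11: "X (1, 1) = (\<Sum>r=1..p2. cmod (\<alpha> m r)) + (\<Sum>q=1..p1. cmod (\<alpha> q n)) - cmod (\<alpha> m n)"
  proof -
    have "{i. i \<in> ?I \<times> ?K \<and> i + (1, 1) \<notin> ?I \<times> ?K}
        = {i. i \<in> ?I \<times> ?K \<and> (fst i = m + p1 \<or> snd i = n + p2)}"
      using assms by auto
    then have "X (1, 1) = (\<Sum>i | i \<in> ?I \<times> ?K \<and> (fst i = m + p1 \<or> snd i = n + p2). cmod (\<alpha> (fst i) (snd i)))"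
      by (simp add: X_def jbj_weight_def case_prod_unfold)
    then show ?thesis
      using cross[OF p\<alpha>, of "n + p2"] \<open>p2 > 0\<close> by (simp add: per[OF \<alpha>])
  qed
  have X1m: "X (1, -1) = (\<Sum>r=1..p2. cmod (\<alpha> m r)) + (\<Sum>q=1..p1. cmod (\<alpha> q n)) - cmod (\<alpha> m n)"
  proof -
    have "{i. i \<in> ?I \<times> ?K \<and> i + (1, -1) \<notin> ?I \<times> ?K}
        = {i. i \<in> ?I \<times> ?K \<and> (fst i = m + p1 \<or> snd i = n + 1)}"
      using assms by auto
    then have "X (1, -1) = (\<Sum>i | i \<in> ?I \<times> ?K \<and> (fst i = m + p1 \<or> snd i = n + 1). cmod (\<alpha> (fst i) (snd i - 1)))"
      by (simp add: X_def jbj_weight_def case_prod_unfold)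
    also have "\<dots> = (\<Sum>r=1..p2. cmod (\<alpha> m (r - 1))) + (\<Sum>q=1..p1. cmod (\<alpha> q n)) - cmod (\<alpha> m n)"
      using cross[OF p\<alpha>', of "n + 1"] \<open>p2 > 0\<close> by simp
    \<comment> \<open>The conjugated weights are stored one step lower, which shifts the window of summation.\<close>
    also have "(\<Sum>r=1..p2. cmod (\<alpha> m (r - 1))) = (\<Sum>r=1..p2. cmod (\<alpha> m r))"
    proof -
      have "(\<Sum>r=1..p2. cmod (\<alpha> m (r - 1))) = (\<Sum>r=-1+1..-1+p2. cmod (\<alpha> m r))"
        by (rule sum.reindex_bij_witness[of _ "\<lambda>r. r + 1" "\<lambda>r. r - 1"]) auto
      also have "\<dots> = (\<Sum>r=1..p2. cmod (\<alpha> m r))"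
        using p\<alpha> \<open>p2 > 0\<close> unfolding periodic2_def
        by (intro sum_periodic_window) (metis add.right_neutral mult_zero_left)+
      finally show ?thesis .
    qed
    finally show ?thesis .
  qed
  have "(\<Sum>s\<in>jbj_offsets. X s) = X (0, 1) + X (1, 0) + X (1, 1) + X (1, -1)"
    by (simp add: jbj_offsets_def)
  then show ?thesis
    unfolding X_def[symmetric] X01 X10 X11 X1m jbj_R_def sum.distrib sum_distrib_left[symmetric]
    by simp
qed

theorem theorem1p1:
  fixes p1 p2 :: int
    and a c :: "int \<Rightarrow> int \<Rightarrow> real"
    and \<alpha> b :: "int \<Rightarrow> int \<Rightarrow> complex"
  assumes "p1 \<ge> 3" and "p2 \<ge> 3"
    and "periodic2 p1 p2 a" and "periodic2 p1 p2 \<alpha>"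
    and "periodic2 p1 p2 c" and "periodic2 p1 p2 b"
  shows "emeasure lebesgue {x::real. complex_of_real x \<in> spectrum (jbj a \<alpha> c b)}
           \<le> ennreal (MIN (m, n)\<in>UNIV. jbj_R p1 p2 a \<alpha> b m n)"
proof -
  have p: "p1 > 0" "p2 > 0"
    using assms by auto
  have "Min (range (\<lambda>(m, n). jbj_R p1 p2 a \<alpha> b m n)) \<in> range (\<lambda>(m, n). jbj_R p1 p2 a \<alpha> b m n)"
    by (rule Min_in[OF finite_range_jbj_R[OF p assms(3,4,6)]]) simp
  then obtain m n where mn: "(MIN (m, n)\<in>UNIV. jbj_R p1 p2 a \<alpha> b m n) = jbj_R p1 p2 a \<alpha> b m n"
    by auto
  let ?T = "range (\<lambda>(k1, k2). (k1 * p1, k2 * p2))" and ?F = "{m+1..m+p1} \<times> {n+1..n+p2}"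
  let ?c = "\<lambda>(q, r). c q r" and ?w = "jbj_weight a \<alpha> b"
  interpret cell_tiling ?T ?F
    by (rule cell_tiling_rectangle[OF p])
  have per: "h (k1 * p1 + q) (k2 * p2 + r) = h q r" if "periodic2 p1 p2 h" for h :: "int \<Rightarrow> int \<Rightarrow> 'c" and q r k1 k2
    using that unfolding periodic2_def by (metis add.commute)
  have pc: "periodic ?c"
    by (auto simp: periodic_def per[OF assms(5)])
  have pw: "periodic (?w s)" for s
    by (auto simp: periodic_def jbj_weight_def per[OF assms(3)] per[OF assms(4)] per[OF assms(6)]
        add_diff_eq[symmetric])
  have fin: "finite jbj_offsets"
    by (simp add: jbj_offsets_def)
  note bnd = periodic_bounded[OF pc] periodic_bounded[OF pw]
  show ?thesis
  proof (rule lattice_op_invertible_off_small_set[of ?c jbj_offsets ?w, OF pc pw fin])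
    fix E :: "real set"
    assume E: "E \<in> sets borel"
      "emeasure lborel E \<le> ennreal (4 * (\<Sum>s\<in>jbj_offsets. \<Sum>f | f \<in> ?F \<and> f + s \<notin> ?F. cmod (?w s f)))"
      "\<And>x. x \<notin> E \<Longrightarrow> bij (\<lambda>u. lattice_op ?c jbj_offsets ?w u - x *\<^sub>R u)
          \<and> (\<exists>k>0. \<forall>u. k * norm u \<le> norm (lattice_op ?c jbj_offsets ?w u - x *\<^sub>R u))"
    have "complex_of_real x \<notin> spectrum (jbj a \<alpha> c b)" if x: "x \<notin> E" for x
    proof -
      obtain k where k: "k > 0" "\<And>u. k * norm u \<le> norm (lattice_op ?c jbj_offsets ?w u - x *\<^sub>R u)"
        and bij: "bij (\<lambda>u. lattice_op ?c jbj_offsets ?w u - x *\<^sub>R u)"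
        using E(3)[OF x] by blast
      have lin: "bounded_linear (lattice_op ?c jbj_offsets ?w)"
        by (rule bounded_linear_lattice_op[of ?c jbj_offsets ?w, OF bnd])
      show ?thesis
      proof (rule not_in_spectrum[OF jbj_eq_lattice_op[of _ c a \<alpha> b, OF _ bnd] _ _ bij k])
        show "lattice_op ?c jbj_offsets ?w (u + v) = lattice_op ?c jbj_offsets ?w u + lattice_op ?c jbj_offsets ?w v" for u v
          using linear_add[OF bounded_linear.linear[OF lin]] .
        show "lattice_op ?c jbj_offsets ?w (mult_op (\<lambda>_. z) u) = mult_op (\<lambda>_. z) (lattice_op ?c jbj_offsets ?w u)" for z u
          by (rule ell2_eqI) (simp add: coord_lattice_op[of ?c jbj_offsets ?w, OF bnd] sum_distrib_left algebra_simps)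
      qed
    qed
    then have "{x. complex_of_real x \<in> spectrum (jbj a \<alpha> c b)} \<subseteq> E"
      by blast
    then have "emeasure lebesgue {x. complex_of_real x \<in> spectrum (jbj a \<alpha> c b)} \<le> emeasure lebesgue E"
      by (rule emeasure_mono) (use E(1) in simp)
    also have "\<dots> = emeasure lborel E"
      using E(1) by simp
    also have "\<dots> \<le> ennreal (jbj_R p1 p2 a \<alpha> b m n)"
      using E(2) crossing_weight_eq_jbj_R[OF p assms(3,4,6), of m n] by simp
    finally show ?thesis
      by (simp only: mn)
  qed
qed

end
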